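(* Let $\mathcal{M}=G/H$ be a homogeneous space with a homogeneous ($G$-invariant) cone field $\mathcal{K}$ that induces a global partial order $\leq_{\mathcal{K}}$ on $\mathcal{M}$. Then a smooth map $F:\mathcal{M}\to\mathcal{M}$ is monotone with respect to $\leq_{\mathcal{K}}$ if and only if $F$ is differentially positive with respect to $\mathcal{K}$, i.e. if and only if $dF|_x\,\mathcal{K}(x)\subseteq\mathcal{K}(F(x))$ for every $x\in\mathcal{M}$.
   Context: Homogeneous space: $G$ is a connected Lie group acting transitively on the manifold $\mathcal{M}$, $H$ is the closed isotropy subgroup of a base-point $o$, $\mathcal{M}\cong G/H$, and $\tau_g(x)=g\cdot x$. Homogeneous cone field: an assignment to each $x\in\mathcal{M}$ of a closed convex pointed cone $\mathcal{K}(x)\subset T_x\mathcal{M}$ (closed under multiplication by nonnegative scalars, with $\mathcal{K}(x)\cap-\mathcal{K}(x)=\{0\}$) such that $d\tau_g|_x\,\mathcal{K}(x)=\mathcal{K}(g\cdot x)$ for all $g\in G$, $x\in\mathcal{M}$. Conal curve: a continuous piecewise smooth curve $\gamma:[t_0,t_1]\to\mathcal{M}$ with $\gamma'(t)\in\mathcal{K}(\gamma(t))$ whenever the derivative exists. Write $a\prec b$ if there is a conal curve $\gamma:[0,1]\to\mathcal{M}$ with $\gamma(0)=a$ and $\gamma(1)=b$. The closed conal order is defined by $x\leq_{\mathcal{K}}y$ if and only if $y\in\overline{\{z\in\mathcal{M}:x\prec z\}}$. The cone field induces a global partial order ($\mathcal{M}$ is globally orderable) if $\leq_{\mathcal{K}}$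 is reflexive, antisymmetric and transitive. Monotone: $F$ is monotone with respect to $\leq_{\mathcal{K}}$ if $F(x_1)\leq_{\mathcal{K}}F(x_2)$ whenever $x_1\leq_{\mathcal{K}}x_2$. *)

theory Defs
  imports "HOL-Analysis.Analysis" "HOL-Algebra.Group_Action"
begin

section \<open>Smooth manifolds\<close>

text \<open>\<open>k\<close>-fold continuous differentiability on an open set of a finite-dimensional space, in terms of
  iterated directional derivatives.\<close>

primrec Ck_on ::
    "nat \<Rightarrow> 'a::euclidean_space set \<Rightarrow> ('a \<Rightarrow> 'b::euclidean_space) \<Rightarrow> bool" where
  "Ck_on 0 S f \<longleftrightarrow> continuous_on S f"
| "Ck_on (Suc k) S f \<longleftrightarrow>
     (\<forall>x\<in>S. f differentiable (at x)) \<and> (\<forall>v. Ck_on k S (\<lambda>x. frechet_derivative f (at x) v))"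

definition smooth_on :: "'a::euclidean_space set \<Rightarrow> ('a \<Rightarrow> 'b::euclidean_space) \<Rightarrow> bool" where
  "smooth_on S f \<longleftrightarrow> (\<forall>k. Ck_on k S f)"

text \<open>A chart is a pair of an open domain \<open>U\<close> and a map \<open>\<phi>\<close> whose values outside \<open>U\<close> are irrelevant.
  A manifold is a type (Hausdorff and second countable via its sort) with a smooth atlas on it;
  since smoothness of maps is tested in all charts of compatible atlases, the atlas need not be
  maximal.\<close>

type_synonym ('m, 'e) chart = "'m set \<times> ('m \<Rightarrow> 'e)"

definition is_chart :: "('m::topological_space, 'e::euclidean_space) chart \<Rightarrow> bool" where
  "is_chart c \<longleftrightarrow> (case c of (U, \<phi>) \<Rightarrow>
     open U \<and> open (\<phi> ` U) \<and> homeomorphism U (\<phi> ` U) \<phi> (inv_into U \<phi>))"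

definition smooth_atlas :: "('m::topological_space, 'e::euclidean_space) chart set \<Rightarrow> bool" where
  "smooth_atlas A \<longleftrightarrow>
     (\<forall>c\<in>A. is_chart c) \<and> (\<Union>c\<in>A. fst c) = UNIV \<and>
     (\<forall>(U, \<phi>)\<in>A. \<forall>(V, \<psi>)\<in>A. smooth_on (\<phi> ` (U \<inter> V)) (\<psi> \<circ> inv_into U \<phi>))"

definition euclidean_atlas :: "('e::euclidean_space, 'e) chart set" where
  "euclidean_atlas = {(UNIV, id)}"

definition product_atlas ::
    "('m, 'e) chart set \<Rightarrow> ('n, 'f) chart set \<Rightarrow> ('m \<times> 'n, 'e \<times> 'f) chart set" where
  "product_atlas A B = {(U \<times> V, map_prod \<phi> \<psi>) | U \<phi> V \<psi>. (U, \<phi>) \<in> A \<and> (V, \<psi>) \<in> B}"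

text \<open>The set \<open>S\<close> is meant to be open.\<close>

definition smooth_map_on ::
    "('m::topological_space, 'e::euclidean_space) chart set \<Rightarrow>
     ('n::topological_space, 'f::euclidean_space) chart set \<Rightarrow> 'm set \<Rightarrow> ('m \<Rightarrow> 'n) \<Rightarrow> bool" where
  "smooth_map_on A B S f \<longleftrightarrow>
     continuous_on S f \<and>
     (\<forall>(U, \<phi>)\<in>A. \<forall>(V, \<psi>)\<in>B. smooth_on (\<phi> ` (U \<inter> S \<inter> f -` V)) (\<psi> \<circ> f \<circ> inv_into U \<phi>))"

abbreviation smooth_map ::
    "('m::topological_space, 'e::euclidean_space) chart set \<Rightarrow>
     ('n::topological_space, 'f::euclidean_space) chart set \<Rightarrow> ('m \<Rightarrow> 'n) \<Rightarrow> bool" where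
  "smooth_map A B f \<equiv> smooth_map_on A B UNIV f"


section \<open>Tangent vectors and differentials\<close>

text \<open>The tangent space at \<open>x\<close> is represented by the model space, through a chart chosen once
  and for all for every point. The tangent spaces at different points are thus not identified with
  one another: vectors at \<open>x\<close> and \<open>y\<close> are compared only through differentials of maps.\<close>

definition chart_at :: "('m, 'e) chart set \<Rightarrow> 'm \<Rightarrow> ('m, 'e) chart" where
  "chart_at A x = (SOME c. c \<in> A \<and> x \<in> fst c)"

definition coord_at :: "('m, 'e) chart set \<Rightarrow> 'm \<Rightarrow> 'm \<Rightarrow> 'e" where
  "coord_at A x = snd (chart_at A x)"

definition param_at :: "('m, 'e) chart set \<Rightarrow> 'm \<Rightarrow> 'e \<Rightarrow> 'm" where
  "param_at A x = inv_into (fst (chart_at A x)) (snd (chart_at A x))"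

definition differential ::
    "('m, 'e::euclidean_space) chart set \<Rightarrow> ('n, 'f::euclidean_space) chart set \<Rightarrow>
     ('m \<Rightarrow> 'n) \<Rightarrow> 'm \<Rightarrow> 'e \<Rightarrow> 'f" where
  "differential A B f x =
     frechet_derivative (coord_at B (f x) \<circ> f \<circ> param_at A x) (at (coord_at A x x))"

definition has_velocity_within ::
    "('m, 'e::euclidean_space) chart set \<Rightarrow> (real \<Rightarrow> 'm) \<Rightarrow> 'e \<Rightarrow> real \<Rightarrow> real set \<Rightarrow> bool" where
  "has_velocity_within A \<gamma> v t T \<longleftrightarrow>
     ((coord_at A (\<gamma> t) \<circ> \<gamma>) has_vector_derivative v) (at t within T)"


section \<open>Homogeneous spaces\<close>

definition lie_group ::
    "('g::topological_space) monoid \<Rightarrow> ('g, 'd::euclidean_space) chart set \<Rightarrow> bool" where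
  "lie_group G A \<longleftrightarrow>
     group G \<and> carrier G = UNIV \<and> smooth_atlas A \<and>
     smooth_map (product_atlas A A) A (\<lambda>(g, h). g \<otimes>\<^bsub>G\<^esub> h) \<and>
     smooth_map A A (\<lambda>g. inv\<^bsub>G\<^esub> g)"

text \<open>A connected Lie group acting smoothly and transitively. The isotropy subgroup of a base-point
  \<open>x\<close> is \<open>stabilizer G \<tau> x\<close>; it is closed because the action is continuous, and the orbit map of \<open>x\<close>
  identifies \<open>G/H\<close> with the manifold.\<close>

definition homogeneous_space ::
    "('g::topological_space) monoid \<Rightarrow> ('g, 'd::euclidean_space) chart set \<Rightarrow>
     ('m::topological_space, 'e::euclidean_space) chart set \<Rightarrow> ('g \<Rightarrow> 'm \<Rightarrow> 'm) \<Rightarrow> bool" where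
  "homogeneous_space G B A \<tau> \<longleftrightarrow>
     lie_group G B \<and> connected (UNIV :: 'g set) \<and> smooth_atlas A \<and>
     transitive_action G UNIV \<tau> \<and>
     smooth_map (product_atlas B A) A (\<lambda>(g, x). \<tau> g x)"


section \<open>Cone fields and conal orders\<close>

definition cone_field :: "('m \<Rightarrow> 'e::euclidean_space set) \<Rightarrow> bool" where
  "cone_field K \<longleftrightarrow>
     (\<forall>x. closed (K x) \<and> convex_cone (K x) \<and> K x \<inter> uminus ` K x = {0})"

definition homogeneous_cone_field ::
    "'g monoid \<Rightarrow> ('m, 'e::euclidean_space) chart set \<Rightarrow> ('g \<Rightarrow> 'm \<Rightarrow> 'm) \<Rightarrow> ('m \<Rightarrow> 'e set) \<Rightarrow> bool" where
  "homogeneous_cone_field G A \<tau> K \<longleftrightarrow>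
     cone_field K \<and> (\<forall>g\<in>carrier G. \<forall>x. differential A A (\<tau> g) x ` K x = K (\<tau> g x))"

text \<open>Smoothness on a compact interval, including one-sided smoothness at its end points, is
  expressed by a smooth extension.\<close>

definition smooth_arc ::
    "('m::topological_space, 'e::euclidean_space) chart set \<Rightarrow> real \<Rightarrow> real \<Rightarrow> (real \<Rightarrow> 'm) \<Rightarrow> bool" where
  "smooth_arc A a b \<gamma> \<longleftrightarrow>
     (\<exists>W \<delta>. open W \<and> {a..b} \<subseteq> W \<and> smooth_map_on euclidean_atlas A W \<delta> \<and> (\<forall>t\<in>{a..b}. \<delta> t = \<gamma> t))"

text \<open>The set \<open>S\<close> contains the break points.\<close>

definition piecewise_smooth_curve ::
    "('m::topological_space, 'e::euclidean_space) chart set \<Rightarrow> real \<Rightarrow> real \<Rightarrow> (real \<Rightarrow> 'm) \<Rightarrow> bool" where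
  "piecewise_smooth_curve A t0 t1 \<gamma> \<longleftrightarrow>
     continuous_on {t0..t1} \<gamma> \<and>
     (\<exists>S. finite S \<and>
        (\<forall>a b. t0 \<le> a \<and> a < b \<and> b \<le> t1 \<and> {a<..<b} \<inter> S = {} \<longrightarrow> smooth_arc A a b \<gamma>))"

definition conal_curve ::
    "('m::topological_space, 'e::euclidean_space) chart set \<Rightarrow> ('m \<Rightarrow> 'e set) \<Rightarrow>
     real \<Rightarrow> real \<Rightarrow> (real \<Rightarrow> 'm) \<Rightarrow> bool" where
  "conal_curve A K t0 t1 \<gamma> \<longleftrightarrow>
     piecewise_smooth_curve A t0 t1 \<gamma> \<and>
     (\<forall>t\<in>{t0..t1}. \<forall>v. has_velocity_within A \<gamma> v t {t0..t1} \<longrightarrow> v \<in> K (\<gamma> t))"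

definition conal_prec ::
    "('m::topological_space, 'e::euclidean_space) chart set \<Rightarrow> ('m \<Rightarrow> 'e set) \<Rightarrow> 'm \<Rightarrow> 'm \<Rightarrow> bool" where
  "conal_prec A K x y \<longleftrightarrow> (\<exists>\<gamma>. conal_curve A K 0 1 \<gamma> \<and> \<gamma> 0 = x \<and> \<gamma> 1 = y)"

definition conal_le ::
    "('m::topological_space, 'e::euclidean_space) chart set \<Rightarrow> ('m \<Rightarrow> 'e set) \<Rightarrow> 'm \<Rightarrow> 'm \<Rightarrow> bool" where
  "conal_le A K x y \<longleftrightarrow> y \<in> closure {z. conal_prec A K x z}"

definition globally_orderable ::
    "('m::topological_space, 'e::euclidean_space) chart set \<Rightarrow> ('m \<Rightarrow> 'e set) \<Rightarrow> bool" where
  "globally_orderable A K \<longleftrightarrow>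
     reflp (conal_le A K) \<and> antisymp (conal_le A K) \<and> transp (conal_le A K)"

definition differentially_positive ::
    "('m, 'e::euclidean_space) chart set \<Rightarrow> ('m \<Rightarrow> 'e set) \<Rightarrow> ('m \<Rightarrow> 'm) \<Rightarrow> bool" where
  "differentially_positive A K F \<longleftrightarrow> (\<forall>x. differential A A F x ` K x \<subseteq> K (F x))"

end

theory Submission
  imports Defs
begin

text \<open>If \<open>F\<close> is differentially positive, it maps conal curves to conal curves, and continuity passes
  this on to the closed order.

  Conversely, let \<open>v \<in> K x\<close>. Some conal curve \<open>\<gamma>\<close> leaves \<open>x\<close> with velocity \<open>v\<close>: the orbit map is open by
  Baire's theorem, hence a submersion (its rank is constant, and a rank-deficient image would be
  negligible), so \<open>v\<close> is the velocity of the orbit of a one-parameter subgroup, and homogeneity makes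
  this orbit conal. By monotonicity \<open>F \<circ> \<gamma>\<close> stays above \<open>y = F x\<close>. If \<open>w = dF v\<close> were outside \<open>K y\<close>, some
  linear functional would be negative at \<open>w\<close> but strictly positive on \<open>K y - {0}\<close>, and hence nonnegative
  on the cones at points near \<open>y\<close>. Antisymmetry forces conal curves from \<open>y\<close> that end near \<open>y\<close> to stay
  near \<open>y\<close>, so the functional is at least its value at \<open>y\<close> on all points above \<open>y\<close> near \<open>y\<close>,
  contradicting its decrease along \<open>F \<circ> \<gamma>\<close>.\<close>

section \<open>Calculus of smooth maps\<close>

text \<open>No continuity of \<open>K\<close> in the base point is assumed, and tangent vectors at
  different points are recorded in unrelated charts. What links nearby cones is invariance under
  translations, which becomes usable once all points near \<open>y\<close> are reached by group
  elements near the identity. The openness of the orbit map therefore serves twice: to compare cones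
  and to produce curves with prescribed velocity.

  The second obstacle is the closure in the definition of the order. A point above \<open>y\<close>
  is only a limit of endpoints of conal curves from \<open>y\<close>, and these curves may leave the
  chart in which the functional is defined; this is why they must be confined near \<open>y\<close>.
  The confinement argument has to vary the starting point of a curve as well as its end, and
  translations make this possible too: a curve from a nearby point is moved to one from the given
  point.\<close>

lemma frechet_derivative_cong_open:
  assumes "open S" "x \<in> S" "\<And>y. y \<in> S \<Longrightarrow> f y = g y"
  shows "frechet_derivative f (at x) = frechet_derivative g (at x)"
proof -
  have "(f has_derivative D) (at x) \<longleftrightarrow> (g has_derivative D) (at x)" for D
    using has_derivative_transform_within_open[OF _ assms(1,2)] assms(3) by metis
  then show ?thesis
    by (simp add: frechet_derivative_def)
qed

text \<open>\<open>Ck_on\<close> iterates the chosen function \<open>frechet_derivative\<close>. Any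
  family \<open>f'\<close> that is a derivative on \<open>S\<close> may replace it, since on an open
  set \<open>Ck_on\<close> depends only on the values there; the local fact \<open>cong\<close>
  supplies this.\<close>

lemma Ck_on_SucI:
  assumes "open S" "\<And>x. x \<in> S \<Longrightarrow> (f has_derivative f' x) (at x)" "\<And>v. Ck_on k S (\<lambda>x. f' x v)"
  shows "Ck_on (Suc k) S f"
proof -
  have cong: "Ck_on k S g" if "Ck_on k S h" "\<And>x. x \<in> S \<Longrightarrow> h x = g x" 
    for g h :: "'a \<Rightarrow> 'b"
    using that
  proof (induction k arbitrary: g h)
    case 0
    then show ?case by (simp cong: continuous_on_cong)
  next
    case (Suc k)
    have "g differentiable (at x)" if "x \<in> S" for x
    proof -
      have "(h has_derivative frechet_derivative h (at x)) (at x)"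
        using Suc.prems(1) that frechet_derivative_works by auto
      from has_derivative_transform_within_open[OF this \<open>open S\<close> that] Suc.prems(2) 
      show ?thesis unfolding differentiable_def by blast
    qed
    moreover have "Ck_on k S (\<lambda>x. frechet_derivative g (at x) v)" for v
    proof (rule Suc.IH)
      show "Ck_on k S (\<lambda>x. frechet_derivative h (at x) v)" using Suc.prems(1) by simp
      show "frechet_derivative h (at x) v = frechet_derivative g (at x) v" if "x \<in> S" for x
        using frechet_derivative_cong_open[OF \<open>open S\<close> that, of g h] Suc.prems(2) by simp
    qed
    ultimately show ?case by simp
  qed
  have "frechet_derivative f (at x) = f' x" if "x \<in> S" for x
    using assms(2)[OF that] frechet_derivative_at by metis
  then have "Ck_on k S (\<lambda>x. frechet_derivative f (at x) v)" for v
    by (intro cong[OF assms(3)[of v]]) simp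
  then show ?thesis
    using assms(2) by (auto simp: differentiable_def)
qed

lemma Ck_on_SucD:
  assumes "Ck_on (Suc k) S f"
  shows "x \<in> S \<Longrightarrow> (f has_derivative frechet_derivative f (at x)) (at x)"
    and "Ck_on k S (\<lambda>x. frechet_derivative f (at x) v)"
  using assms frechet_derivative_works by auto

lemma Ck_on_Suc_imp: "Ck_on (Suc k) S f \<Longrightarrow> Ck_on k S f"
proof (induction k arbitrary: f)
  case 0
  then show ?case
    by (auto intro!: continuous_at_imp_continuous_on differentiable_imp_continuous_within)
next
  case (Suc k)
  then show ?case by simp
qed

lemma Ck_on_cong:
  assumes "open S" "Ck_on k S f" "\<And>x. x \<in> S \<Longrightarrow> f x = g x"
  shows "Ck_on k S g"
proof (cases k)
  case 0
  then show ?thesis using assms by (simp cong: continuous_on_cong)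
next
  case (Suc n)
  show ?thesis unfolding Suc
  proof (rule Ck_on_SucI[OF assms(1)])
    fix x assume "x \<in> S"
    from Ck_on_SucD(1)[OF assms(2)[unfolded Suc] this]
    show "(g has_derivative frechet_derivative f (at x)) (at x)"
      using has_derivative_transform_within_open[OF _ assms(1) \<open>x \<in> S\<close>] assms(3) by blast
  next
    show "Ck_on n S (\<lambda>x. frechet_derivative f (at x) v)" for v
      using assms(2) Suc by simp
  qed
qed

lemma Ck_on_subset: "Ck_on k S f \<Longrightarrow> T \<subseteq> S \<Longrightarrow> Ck_on k T f"
  by (induction k arbitrary: f) (auto intro: continuous_on_subset)

lemma Ck_on_local:
  assumes "\<And>x. x \<in> S \<Longrightarrow> \<exists>T. open T \<and> x \<in> T \<and> Ck_on k T f"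
  shows "Ck_on k S f"
  using assms
proof (induction k arbitrary: f)
  case 0
  then have "isCont f x" if "x \<in> S" for x
    using that by (metis Ck_on.simps(1) continuous_on_eq_continuous_at)
  then show ?case by (simp add: continuous_at_imp_continuous_on)
next
  case (Suc k)
  have "f differentiable (at x)" if "x \<in> S" for x
    using Suc.prems[OF that] by auto
  moreover have "Ck_on k S (\<lambda>x. frechet_derivative f (at x) v)" for v
  proof (rule Suc.IH)
    show "\<exists>T. open T \<and> x \<in> T \<and> Ck_on k T (\<lambda>x. frechet_derivative f (at x) v)" if "x \<in> S" for x
      using Suc.prems[OF that] by auto
  qed
  ultimately show ?case by simp
qed

lemma Ck_on_const: "open S \<Longrightarrow> Ck_on k S (\<lambda>x. c)"
proof (induction k arbitrary: c)
  case (Suc k)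
  then show ?case
    by (intro Ck_on_SucI[where f' = "\<lambda>x v. 0"]) auto
qed simp

lemma Ck_on_linear: "open S \<Longrightarrow> bounded_linear L \<Longrightarrow> Ck_on k S L"
proof (induction k)
  case 0
  then show ?case by (simp add: linear_continuous_on)
next
  case (Suc k)
  show ?case
    by (rule Ck_on_SucI[where f' = "\<lambda>x. L"])
      (use Suc in \<open>auto intro: bounded_linear_imp_has_derivative Ck_on_const\<close>)
qed

lemma Ck_on_bounded_linear:
  "open S \<Longrightarrow> bounded_linear L \<Longrightarrow> Ck_on k S f \<Longrightarrow> Ck_on k S (\<lambda>x. L (f x))"
proof (induction k arbitrary: f)
  case 0
  then show ?case by (simp add: bounded_linear.continuous_on)
next
  case (Suc k)
  show ?case
    by (rule Ck_on_SucI[OF Suc.prems(1)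
          bounded_linear.has_derivative[OF Suc.prems(2) Ck_on_SucD(1)[OF Suc.prems(3)]]
          Suc.IH[OF Suc.prems(1,2) Ck_on_SucD(2)[OF Suc.prems(3)]]])
qed

lemma Ck_on_add:
  "open S \<Longrightarrow> Ck_on k S f \<Longrightarrow> Ck_on k S g \<Longrightarrow> Ck_on k S (\<lambda>x. f x + g x)"
proof (induction k arbitrary: f g)
  case 0
  then show ?case by (simp add: continuous_on_add)
next
  case (Suc k)
  show ?case
    by (rule Ck_on_SucI[OF Suc.prems(1)
          has_derivative_add[OF Ck_on_SucD(1)[OF Suc.prems(2)] Ck_on_SucD(1)[OF Suc.prems(3)]]
          Suc.IH[OF Suc.prems(1) Ck_on_SucD(2)[OF Suc.prems(2)] Ck_on_SucD(2)[OF Suc.prems(3)]]])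
qed

lemma Ck_on_sum:
  assumes "open S" "finite I" "\<And>i. i \<in> I \<Longrightarrow> Ck_on k S (f i)"
  shows "Ck_on k S (\<lambda>x. \<Sum>i\<in>I. f i x)"
  using assms(2,3) by induction (auto simp: Ck_on_const Ck_on_add assms(1))

lemma Ck_on_scaleR:
  fixes a :: "'a::euclidean_space \<Rightarrow> real"
  shows "open S \<Longrightarrow> Ck_on k S a \<Longrightarrow> Ck_on k S f \<Longrightarrow> Ck_on k S (\<lambda>x. a x *\<^sub>R f x)"
proof (induction k arbitrary: a f)
  case 0
  then show ?case by (simp add: continuous_on_scaleR)
next
  case (Suc k)
  show ?case
  proof (rule Ck_on_SucI)
    show "((\<lambda>x. a x *\<^sub>R f x) has_derivative 
       (\<lambda>v. a x *\<^sub>R frechet_derivative f (at x) v + frechet_derivative a (at x) v *\<^sub>R f x)) (at x)"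
      if "x \<in> S" for x
      using that Suc.prems by (intro has_derivative_scaleR Ck_on_SucD)
    show "Ck_on k S (\<lambda>x. a x *\<^sub>R frechet_derivative f (at x) v + frechet_derivative a (at x) v *\<^sub>R f x)" for v
      using Suc.prems by (intro Ck_on_add Suc.IH Ck_on_SucD) (auto intro: Ck_on_Suc_imp)
  qed fact
qed

lemma linear_expansion:
  assumes "linear L"
  shows "L v = (\<Sum>b\<in>Basis. (v \<bullet> b) *\<^sub>R L b)"
  by (metis (no_types, lifting) assms euclidean_representation linear_cmul linear_sum sum.cong)

text \<open>The derivative of \<open>g\<close> at \<open>f x\<close> is applied to a vector that
  itself varies with \<open>x\<close>, whereas the induction hypothesis covers only fixed
  directions. Expanding that vector in the basis leaves sums of products to which it
  applies.\<close>

lemma Ck_on_compose: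
  assumes "open S" "open T" "f ` S \<subseteq> T" "Ck_on k T g" "Ck_on k S f" 
  shows "Ck_on k S (\<lambda>x. g (f x))"
  using assms(4,5)
proof (induction k arbitrary: g)
  case 0
  then show ?case using assms(3) by (auto intro: continuous_on_compose2)
next
  case (Suc k)
  have D: "((\<lambda>x. g (f x)) has_derivative 
      (\<lambda>v. frechet_derivative g (at (f x)) (frechet_derivative f (at x) v))) (at x)" if "x \<in> S" for x
    using Ck_on_SucD(1)[OF Suc.prems(1)] Ck_on_SucD(1)[OF Suc.prems(2)] that assms(3)
      has_derivative_compose[of f _ x UNIV g] by auto
  have E: "frechet_derivative g (at (f x)) w = (\<Sum>b\<in>Basis. (w \<bullet> b) *\<^sub>R frechet_derivative g (at (f x)) b)"
    if "x \<in> S" for x w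
    using Ck_on_SucD(1)[OF Suc.prems(1)] that assms(3)
    by (intro linear_expansion has_derivative_linear[of g _ "at (f x)"]) auto
  show ?case
  proof (rule Ck_on_SucI[OF assms(1)])
    fix x assume "x \<in> S"
    from D[OF this] show "((\<lambda>x. g (f x)) has_derivative (\<lambda>v. \<Sum>b\<in>Basis. 
      (frechet_derivative f (at x) v \<bullet> b) *\<^sub>R frechet_derivative g (at (f x)) b)) (at x)"
      unfolding E[OF \<open>x \<in> S\<close>, symmetric] .
  next
    fix v
    have "Ck_on k S (\<lambda>x. frechet_derivative f (at x) v \<bullet> b)" for b
      by (rule Ck_on_bounded_linear[OF assms(1) bounded_linear_inner_left Ck_on_SucD(2)[OF Suc.prems(2)]])
    moreover have "Ck_on k S (\<lambda>x. frechet_derivative g (at (f x)) b)" for b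
      by (rule Suc.IH[OF Ck_on_SucD(2)[OF Suc.prems(1)] Ck_on_Suc_imp[OF Suc.prems(2)]])
    ultimately show "Ck_on k S (\<lambda>x. \<Sum>b\<in>Basis. 
      (frechet_derivative f (at x) v \<bullet> b) *\<^sub>R frechet_derivative g (at (f x)) b)"
      by (intro Ck_on_sum Ck_on_scaleR assms(1)) auto
  qed
qed

lemma Ck_on_Pair:
  assumes "open S" "Ck_on k S f" "Ck_on k S g"
  shows "Ck_on k S (\<lambda>x. (f x, g x))"
proof -
  have "bounded_linear (\<lambda>a. (a, 0))" "bounded_linear (\<lambda>b. (0, b))"
    by (intro bounded_linear_Pair bounded_linear_ident bounded_linear_zero)+
  then have "Ck_on k S (\<lambda>x. (f x, 0) + (0, g x))"
    using assms by (intro Ck_on_add Ck_on_bounded_linear[of S "\<lambda>a. (a, 0)"] Ck_on_bounded_linear[of S "\<lambda>b. (0, b)"])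
  then show ?thesis by simp
qed

lemma smooth_on_has_derivative:
  "smooth_on S f \<Longrightarrow> x \<in> S \<Longrightarrow> (f has_derivative frechet_derivative f (at x)) (at x)"
  unfolding smooth_on_def using Ck_on_SucD(1) by blast

lemma smooth_on_derivative: "smooth_on S f \<Longrightarrow> smooth_on S (\<lambda>x. frechet_derivative f (at x) v)"
  unfolding smooth_on_def using Ck_on_SucD(2) by blast

lemma smooth_on_continuous: "smooth_on S f \<Longrightarrow> continuous_on S f"
  unfolding smooth_on_def using Ck_on.simps(1) by blast

lemma smooth_on_compose:
  assumes "open S" "open T" "f ` S \<subseteq> T" "smooth_on T g" "smooth_on S f" 
  shows "smooth_on S (\<lambda>x. g (f x))"
  using assms Ck_on_compose unfolding smooth_on_def by blast

lemma smooth_on_cong: 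
  assumes "open S" "smooth_on S f" "\<And>x. x \<in> S \<Longrightarrow> f x = g x"
  shows "smooth_on S g"
  unfolding smooth_on_def
proof
  show "Ck_on k S g" for k
    by (rule Ck_on_cong[OF assms(1) _ assms(3)]) (use assms(2) in \<open>auto simp: smooth_on_def\<close>)
qed

lemma smooth_on_subset: "smooth_on S f \<Longrightarrow> T \<subseteq> S \<Longrightarrow> smooth_on T f"
  unfolding smooth_on_def using Ck_on_subset by blast

lemma smooth_on_local:
  assumes "\<And>x. x \<in> S \<Longrightarrow> \<exists>T. open T \<and> x \<in> T \<and> smooth_on T f"
  shows "smooth_on S f"
  unfolding smooth_on_def
proof
  show "Ck_on k S f" for k
    by (rule Ck_on_local) (use assms in \<open>auto simp: smooth_on_def\<close>)
qed

lemma smooth_on_Pair: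
  "open S \<Longrightarrow> smooth_on S f \<Longrightarrow> smooth_on S g \<Longrightarrow> smooth_on S (\<lambda>x. (f x, g x))"
  unfolding smooth_on_def using Ck_on_Pair by blast

lemma smooth_on_const: "open S \<Longrightarrow> smooth_on S (\<lambda>x. c)"
  unfolding smooth_on_def using Ck_on_const by blast

lemma smooth_on_linear: "open S \<Longrightarrow> bounded_linear L \<Longrightarrow> smooth_on S L"
  unfolding smooth_on_def using Ck_on_linear by blast

lemma smooth_on_add:
  "open S \<Longrightarrow> smooth_on S f \<Longrightarrow> smooth_on S g \<Longrightarrow> smooth_on S (\<lambda>x. f x + g x)"
  unfolding smooth_on_def using Ck_on_add by blast

lemma smooth_on_affine_real:
  fixes a b :: real and S :: "real set"
  assumes "open S" shows "smooth_on S (\<lambda>t. a + b * t)"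
  by (intro smooth_on_add smooth_on_const smooth_on_linear bounded_linear_mult_right assms)

section \<open>Local solutions of autonomous differential equations\<close>

text \<open>Bootstrapping: if \<open>p\<close> is \<open>k\<close> times continuously
  differentiable, then so is \<open>V\<close> along \<open>p\<close>, which is the derivative of
  \<open>p\<close>.\<close>

lemma solution_smooth:
  fixes p :: "real \<Rightarrow> 'a::euclidean_space"
  assumes "open S" "open D" "smooth_on D V" "p ` S \<subseteq> D"
    and "\<And>t. t \<in> S \<Longrightarrow> (p has_vector_derivative V (p t)) (at t)"
  shows "smooth_on S p"
proof -
  have "Ck_on k S p" for k
  proof (induction k)
    case 0
    show ?case
      using has_vector_derivative_continuous[OF assms(5)]
      by (simp add: continuous_at_imp_continuous_on)
  next
    case (Suc k)
    show ?case
    proof (rule Ck_on_SucI[OF assms(1)])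
      show "(p has_derivative (\<lambda>v. v *\<^sub>R V (p t))) (at t)" if "t \<in> S" for t
        using assms(5)[OF that] by (simp add: has_vector_derivative_def)
      show "Ck_on k S (\<lambda>t. v *\<^sub>R V (p t))" for v
      proof (intro Ck_on_scaleR Ck_on_const assms(1))
        show "Ck_on k S (\<lambda>t. V (p t))"
          using assms(3) by (intro Ck_on_compose[OF assms(1,2,4) _ Suc]) (simp add: smooth_on_def)
      qed
    qed
  qed
  then show ?thesis by (simp add: smooth_on_def)
qed

text \<open>Smoothness gives continuity of the derivative in each fixed direction. On the compact
  ball this bounds it on every basis vector; the sum of these bounds is a bound on the operator
  norm, hence a Lipschitz constant by convexity of the ball.\<close>

lemma smooth_on_locally_lipschitz:
  fixes V :: "'a::euclidean_space \<Rightarrow> 'b::euclidean_space"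
  assumes "smooth_on D V" "cball p r \<subseteq> D"
  obtains L where "L \<ge> 0" "\<And>x y. x \<in> cball p r \<Longrightarrow> y \<in> cball p r \<Longrightarrow> norm (V x - V y) \<le> L * norm (x - y)"
proof -
  have "\<exists>C. \<forall>x\<in>cball p r. norm (frechet_derivative V (at x) b) \<le> C" for b
  proof -
    have "continuous_on (cball p r) (\<lambda>x. frechet_derivative V (at x) b)"
      by (rule continuous_on_subset[OF smooth_on_continuous[OF smooth_on_derivative[OF assms(1)]] assms(2)])
    then have "bounded ((\<lambda>x. frechet_derivative V (at x) b) ` cball p r)"
      by (intro compact_imp_bounded compact_continuous_image compact_cball)
    then show ?thesis unfolding bounded_iff by auto
  qed
  then obtain C where C: "\<And>b x. x \<in> cball p r \<Longrightarrow> norm (frechet_derivative V (at x) b) \<le> C b"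
    by metis
  let ?L = "\<Sum>b\<in>Basis. \<bar>C b\<bar>"
  have lin: "linear (frechet_derivative V (at x))" if "x \<in> cball p r" for x
    using smooth_on_has_derivative[OF assms(1)] that assms(2) has_derivative_linear by blast
  have "onorm (frechet_derivative V (at x)) \<le> ?L" if x: "x \<in> cball p r" for x
  proof (rule onorm_le)
    fix v
    have "norm (frechet_derivative V (at x) v) = norm (\<Sum>b\<in>Basis. (v \<bullet> b) *\<^sub>R frechet_derivative V (at x) b)"
      using linear_expansion[OF lin[OF x]] by metis
    also have "\<dots> \<le> (\<Sum>b\<in>Basis. norm v * \<bar>C b\<bar>)"
      by (rule sum_norm_le)
        (auto intro!: mult_mono Basis_le_norm order_trans[OF C[OF x]])
    finally show "norm (frechet_derivative V (at x) v) \<le> ?L * norm v"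
      by (simp add: sum_distrib_left mult.commute)
  qed
  note onorm = this
  have "norm (V x - V y) \<le> ?L * norm (x - y)" if "x \<in> cball p r" "y \<in> cball p r" for x y
  proof (rule differentiable_bound[of "cball p r" V "\<lambda>x. frechet_derivative V (at x)"])
    show "(V has_derivative frechet_derivative V (at z)) (at z within cball p r)" if "z \<in> cball p r" for z
      using smooth_on_has_derivative[OF assms(1)] that assms(2) by (blast intro: has_derivative_at_withinI)
  qed (use that onorm in auto)
  then show ?thesis by (intro that[of ?L]) (auto intro: sum_nonneg)
qed

text \<open>Banach's fixed point theorem for the integral operator, on bounded continuous functions
  over the whole real line with values in a closed ball around \<open>p0\<close>. Stopping the time
  at \<open>-a\<close> and \<open>a\<close> makes the operator well defined on that complete
  space.\<close>

lemma picard_lindeloef: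
  fixes V :: "'a::euclidean_space \<Rightarrow> 'a"
  assumes "open D" "smooth_on D V" "p0 \<in> D"
  obtains a p where "a > 0" "p 0 = p0" 
    "\<And>t. t \<in> {-a<..<a} \<Longrightarrow> p t \<in> D"
    "\<And>t. t \<in> {-a<..<a} \<Longrightarrow> (p has_vector_derivative V (p t)) (at t)"
proof -
  obtain r where r: "r > 0" "cball p0 r \<subseteq> D" 
    using assms(1,3) open_contains_cball by blast
  let ?C = "cball p0 r"
  have cont: "continuous_on ?C V"
    by (rule continuous_on_subset[OF smooth_on_continuous[OF assms(2)] r(2)])
  obtain L where L: "L \<ge> 0" "\<And>x y. x \<in> ?C \<Longrightarrow> y \<in> ?C \<Longrightarrow> norm (V x - V y) \<le> L * norm (x - y)"
    using smooth_on_locally_lipschitz[OF assms(2) r(2)] by metis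
  have "bounded (V ` ?C)"
    by (intro compact_imp_bounded compact_continuous_image cont compact_cball)
  then obtain M where M: "M > 0" "\<And>x. x \<in> ?C \<Longrightarrow> norm (V x) \<le> M"
    by (auto simp: bounded_pos)
  \<comment> \<open>The factor 3 comes from the two integrals in \<open>I\<close> below, over
    lengths at most \<open>2 * a\<close> and \<open>a\<close>. The first bound keeps the iterates in
    the ball, the second makes the operator a contraction with factor 1/2; \<open>L + 1\<close>
    keeps the denominator positive.\<close>
  define a where "a = min (r / (3 * M)) (1 / (6 * (L + 1)))"
  have a: "a > 0" "3 * a * M \<le> r" "3 * a * L \<le> 1/2"
  proof -
    show "a > 0" using r M L by (simp add: a_def)
    have "a \<le> r / (3 * M)" by (simp add: a_def)
    then show "3 * a * M \<le> r" using M by (simp add: field_simps)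
    have "a \<le> 1 / (6 * (L + 1))" by (simp add: a_def)
    then have "6 * a * (L + 1) \<le> 1" using L by (simp add: field_simps)
    moreover have "6 * a * (L + 1) = 6 * a * L + 6 * a" by (simp add: algebra_simps)
    ultimately have "6 * a * L \<le> 1" using \<open>a > 0\<close> by linarith
    then show "3 * a * L \<le> 1/2" by linarith
  qed
  define c where "c t = max (-a) (min a t)" for t
  have c: "c t \<in> {-a..a}" for t using a(1) by (auto simp: c_def)
  have contc: "continuous_on UNIV c" unfolding c_def by (intro continuous_intros)
  \<comment> \<open>The signed integral from 0 to \<open>c t\<close>, written as a difference so
    that negative \<open>t\<close> is treated uniformly.\<close>
  define I where "I h t = integral {-a..c t} h - integral {-a..0} h" for h :: "real \<Rightarrow> 'a" and t
  have int: "h integrable_on {-a..t}" if "continuous_on UNIV h" for h :: "real \<Rightarrow> 'a" and t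
    using that continuous_on_subset integrable_continuous_interval by blast
  have I_diff: "I h t - I k t = I (\<lambda>s. h s - k s) t" 
    if "continuous_on UNIV h" "continuous_on UNIV k" for h k t
    using int[OF that(1)] int[OF that(2)] by (simp add: I_def Henstock_Kurzweil_Integration.integral_diff)
  have I_bound: "norm (I h t) \<le> 3 * a * B" 
    if "continuous_on UNIV h" "\<And>s. norm (h s) \<le> B" for h B t
  proof -
    have "B \<ge> 0" using that(2)[of 0] norm_ge_zero order_trans by blast
    have "norm (integral {-a..c t} h) \<le> B * (c t - (- a))"
      using c[of t] that by (intro integral_bound) (auto intro: continuous_on_subset)
    also have "\<dots> \<le> B * (2 * a)" using c[of t] \<open>B \<ge> 0\<close> by (intro mult_left_mono) auto
    finally have 1: "norm (integral {-a..c t} h) \<le> B * (2 * a)" .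
    have "norm (integral {-a..0} h) \<le> B * (0 - (- a))"
      using a(1) that by (intro integral_bound) (auto intro: continuous_on_subset)
    then show ?thesis using 1 norm_triangle_ineq4[of "integral {-a..c t} h" "integral {-a..0} h"]
      unfolding I_def by (simp add: algebra_simps)
  qed
  define S where "S = PiC UNIV (\<lambda>_::real. ?C)"
  define J where "J f = Bcontfun (\<lambda>t. p0 + I (\<lambda>s. V (apply_bcontfun f s)) t)" for f :: "real \<Rightarrow>\<^sub>C 'a"
  have S: "apply_bcontfun f s \<in> ?C" if "f \<in> S" for f s
    using that unfolding S_def mem_PiC_iff by blast
  have contV: "continuous_on UNIV (\<lambda>s. V (apply_bcontfun f s))" if "f \<in> S" for f
    by (rule continuous_on_compose2[OF cont]) (use S[OF that] in auto)
  have J: "apply_bcontfun (J f) t = p0 + I (\<lambda>s. V (apply_bcontfun f s)) t"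
    "apply_bcontfun (J f) t \<in> ?C" if f: "f \<in> S" for f t
  proof -
    have *: "norm (I (\<lambda>s. V (apply_bcontfun f s)) t) \<le> r" for t
      using I_bound[OF contV[OF f] M(2)[OF S[OF f]]] a(2) by (rule order_trans)
    have "continuous_on UNIV (\<lambda>t. integral {-a..c t} (\<lambda>s. V (apply_bcontfun f s)))"
      by (rule continuous_on_compose2[OF indefinite_integral_continuous_1[OF int[OF contV[OF f], of a]] contc])
        (use c in auto)
    then have "continuous_on UNIV (\<lambda>t. p0 + I (\<lambda>s. V (apply_bcontfun f s)) t)"
      unfolding I_def by (intro continuous_intros)
    moreover have "p0 + I (\<lambda>s. V (apply_bcontfun f s)) t \<in> ?C" for t
      using * by (simp add: dist_norm)
    moreover from this have "bounded (range (\<lambda>t. p0 + I (\<lambda>s. V (apply_bcontfun f s)) t))"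
      by (intro bounded_subset[OF bounded_cball]) blast
    ultimately show "apply_bcontfun (J f) t = p0 + I (\<lambda>s. V (apply_bcontfun f s)) t"
      "apply_bcontfun (J f) t \<in> ?C"
      by (simp_all add: J_def Bcontfun_inverse bcontfun_def)
  qed
  have "\<exists>!f\<in>S. J f = f"
  proof (rule Banach_fix[where c = "1/2"])
    show "complete S" unfolding S_def complete_eq_closed by (intro closed_PiC) auto
    have "const_bcontfun p0 \<in> S"
      using r(1) by (auto simp: S_def mem_PiC_iff const_bcontfun.rep_eq)
    then show "S \<noteq> {}" by blast
    show "J ` S \<subseteq> S"
      using J(2) by (auto simp: S_def mem_PiC_iff)
    show "dist (J f) (J g) \<le> 1/2 * dist f g" if "f \<in> S" "g \<in> S" for f g
    proof (rule dist_bound)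
      fix t
      have "norm (V (apply_bcontfun f s) - V (apply_bcontfun g s)) \<le> L * dist f g" for s
        using L(2)[OF S[OF that(1)] S[OF that(2)], of s s] mult_left_mono[OF dist_bounded[of f s g] L(1)]
        by (simp add: dist_norm)
      then have "norm (I (\<lambda>s. V (apply_bcontfun f s) - V (apply_bcontfun g s)) t) \<le> 3 * a * (L * dist f g)"
        by (intro I_bound continuous_on_diff contV that)
      also have "\<dots> = (3 * a * L) * dist f g" by simp
      also have "\<dots> \<le> 1/2 * dist f g" by (intro mult_right_mono a(3)) simp
      finally show "dist (apply_bcontfun (J f) t) (apply_bcontfun (J g) t) \<le> 1/2 * dist f g"
        using that by (simp add: J(1) dist_norm I_diff[OF contV contV])
    qed
  qed auto
  then obtain f where f: "f \<in> S" "J f = f" by blast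
  have eq: "apply_bcontfun f t = p0 + I (\<lambda>s. V (apply_bcontfun f s)) t" for t
    using J(1)[OF f(1), of t] f(2) by simp
  show thesis
  proof (rule that[of a "apply_bcontfun f"])
    show "a > 0" by fact
    show "apply_bcontfun f 0 = p0" using a(1) by (subst eq) (simp add: I_def c_def)
    show "apply_bcontfun f t \<in> D" for t using S[OF f(1)] r(2) by blast
    fix t assume t: "t \<in> {-a<..<a}"
    have "((\<lambda>u. integral {-a..u} (\<lambda>s. V (apply_bcontfun f s))) has_vector_derivative V (apply_bcontfun f t)) (at t within {-a..a})"
      using t by (intro integral_has_vector_derivative continuous_on_subset[OF contV[OF f(1)]]) auto
    then have "((\<lambda>u. integral {-a..u} (\<lambda>s. V (apply_bcontfun f s))) has_vector_derivative V (apply_bcontfun f t)) (at t)"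
      using t by (simp add: at_within_Icc_at)
    then have *: "((\<lambda>u. p0 + (integral {-a..u} (\<lambda>s. V (apply_bcontfun f s)) - integral {-a..0} (\<lambda>s. V (apply_bcontfun f s)))) 
        has_vector_derivative V (apply_bcontfun f t)) (at t)"
      by (auto intro!: derivative_eq_intros)
    show "(apply_bcontfun f has_vector_derivative V (apply_bcontfun f t)) (at t)"
    proof (rule has_vector_derivative_transform_within_open[OF * _ t])
      fix u assume "u \<in> {-a<..<a}"
      then have "c u = u" by (auto simp: c_def)
      then show "p0 + (integral {-a..u} (\<lambda>s. V (apply_bcontfun f s)) - integral {-a..0} (\<lambda>s. V (apply_bcontfun f s))) = apply_bcontfun f u"
        by (subst (3) eq) (simp add: I_def)
    qed simp
  qed
qed

section \<open>Smooth maps between manifolds\<close>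

text \<open>An atlas without compatibility of its charts. Smoothness of maps is tested in all pairs
  of charts, so composition works at this level, and product atlases can be handled through
  \<open>chart_cover_product\<close> alone.\<close>

definition chart_cover :: "('m::topological_space, 'e::euclidean_space) chart set \<Rightarrow> bool" where
  "chart_cover A \<longleftrightarrow> (\<forall>c\<in>A. is_chart c) \<and> (\<Union>c\<in>A. fst c) = UNIV"

definition local_rep :: 
  "('m, 'e) chart \<Rightarrow> ('n, 'f) chart \<Rightarrow> ('m \<Rightarrow> 'n) \<Rightarrow> 'e \<Rightarrow> 'f" where
  "local_rep c d f = snd d \<circ> f \<circ> inv_into (fst c) (snd c)"

text \<open>The differential in arbitrary charts around \<open>x\<close> and \<open>f x\<close>;
  \<open>differential\<close> is its value for the charts chosen by \<open>chart_at\<close>. For the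
  identity map it is the change of coordinates, which is how vectors given in different charts are
  compared.\<close>

definition diff_in :: 
  "('m, 'e::euclidean_space) chart \<Rightarrow> ('n, 'f::euclidean_space) chart \<Rightarrow> ('m \<Rightarrow> 'n) \<Rightarrow> 'm \<Rightarrow> 'e \<Rightarrow> 'f" where
  "diff_in c d f x = frechet_derivative (local_rep c d f) (at (snd c x))"

lemma is_chartD:
  assumes "is_chart c"
  shows "open (fst c)" "open (snd c ` fst c)" "inj_on (snd c) (fst c)" 
    "continuous_on (fst c) (snd c)" "continuous_on (snd c ` fst c) (inv_into (fst c) (snd c))"
    "x \<in> fst c \<Longrightarrow> inv_into (fst c) (snd c) (snd c x) = x"
  using assms homeomorphism_apply1[of "fst c" "snd c ` fst c" "snd c" "inv_into (fst c) (snd c)" x]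
  by (auto simp: is_chart_def homeomorphism_def inj_on_def split: prod.splits) metis

lemma is_chartI:
  assumes "open U" "open (\<phi> ` U)" "inj_on \<phi> U" "continuous_on U \<phi>" "continuous_on (\<phi> ` U) (inv_into U \<phi>)"
  shows "is_chart (U, \<phi>)"
  using assms by (auto simp: is_chart_def homeomorphism_def)

lemma chart_image_open:
  assumes "is_chart c" "open S"
  shows "open (snd c ` (fst c \<inter> S))"
proof -
  have "snd c ` (fst c \<inter> S) = snd c ` fst c \<inter> inv_into (fst c) (snd c) -` S"
    using is_chartD(6)[OF assms(1)] by force
  then show ?thesis
    using continuous_open_preimage[OF is_chartD(5,2)[OF assms(1)] assms(2)] by simp
qed

lemma smooth_atlas_cover: "smooth_atlas A \<Longrightarrow> chart_cover A"
  by (auto simp: smooth_atlas_def chart_cover_def)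

lemma chart_coverD: "chart_cover A \<Longrightarrow> c \<in> A \<Longrightarrow> is_chart c"
  by (auto simp: chart_cover_def)

lemma chart_coverE:
  assumes "chart_cover A" obtains c where "c \<in> A" "x \<in> fst c"
  using assms by (fastforce simp: chart_cover_def)

lemma chart_at_in: 
  assumes "chart_cover A" shows "chart_at A x \<in> A" "x \<in> fst (chart_at A x)"
  using someI_ex[of "\<lambda>c. c \<in> A \<and> x \<in> fst c"] chart_coverE[OF assms, of x]
  unfolding chart_at_def by metis+

lemma chart_cover_euclidean: "chart_cover euclidean_atlas"
  by (auto simp: chart_cover_def euclidean_atlas_def is_chart_def homeomorphism_def)

lemma inv_into_map_prod:
  assumes "inj_on \<psi> U" "inj_on \<phi> V" "p \<in> \<psi> ` U" "q \<in> \<phi> ` V"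
  shows "inv_into (U \<times> V) (map_prod \<psi> \<phi>) (p, q) = (inv_into U \<psi> p, inv_into V \<phi> q)"
  using assms by (intro inv_into_f_eq map_prod_inj_on) (auto simp: f_inv_into_f inv_into_into)

lemma chart_cover_product:
  assumes "chart_cover A" "chart_cover B"
  shows "chart_cover (product_atlas A B)"
  unfolding chart_cover_def
proof
  show "\<forall>c\<in>product_atlas A B. is_chart c"
  proof
    fix c assume "c \<in> product_atlas A B"
    then obtain U \<phi> V \<psi> where c: "c = (U \<times> V, map_prod \<phi> \<psi>)" "(U, \<phi>) \<in> A" "(V, \<psi>) \<in> B"
      by (auto simp: product_atlas_def)
    note ch = is_chartD[OF chart_coverD[OF assms(1) c(2)], simplified] 
      is_chartD[OF chart_coverD[OF assms(2) c(3)], simplified]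
    have im: "map_prod \<phi> \<psi> ` (U \<times> V) = \<phi> ` U \<times> \<psi> ` V" by (rule map_prod_surj_on) auto
    have "continuous_on (\<phi> ` U \<times> \<psi> ` V) (\<lambda>z. (inv_into U \<phi> (fst z), inv_into V \<psi> (snd z)))"
      by (intro continuous_on_Pair continuous_on_compose2[OF ch(5)] continuous_on_compose2[OF ch(11)] 
          continuous_intros) auto
    then have inv: "continuous_on (\<phi> ` U \<times> \<psi> ` V) (inv_into (U \<times> V) (map_prod \<phi> \<psi>))"
      by (rule continuous_on_eq) (use inv_into_map_prod[OF ch(3,9)] in auto)
    have "continuous_on (U \<times> V) (\<lambda>z. (\<phi> (fst z), \<psi> (snd z)))"
      by (intro continuous_on_Pair continuous_on_compose2[OF ch(4)] continuous_on_compose2[OF ch(10)] 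
          continuous_intros) auto
    then have cont: "continuous_on (U \<times> V) (map_prod \<phi> \<psi>)"
      by (simp add: map_prod_def case_prod_unfold)
    show "is_chart c" unfolding c(1)
      by (rule is_chartI) (use ch inv cont in \<open>auto simp: im open_Times intro!: map_prod_inj_on\<close>)
  qed
  show "(\<Union>c\<in>product_atlas A B. fst c) = UNIV"
  proof -
    have "\<exists>c\<in>product_atlas A B. (x, y) \<in> fst c" for x y
    proof -
      obtain c d where "c \<in> A" "x \<in> fst c" "d \<in> B" "y \<in> fst d"
        using chart_coverE assms by metis
      then show ?thesis
        by (intro bexI[of _ "(fst c \<times> fst d, map_prod (snd c) (snd d))"]) 
          (auto simp: product_atlas_def intro!: exI[of _ "fst c"] exI[of _ "snd c"] exI[of _ "fst d"] exI[of _ "snd d"])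
    qed
    then show ?thesis by auto
  qed
qed

lemma smooth_map_onD:
  assumes "smooth_map_on A B S f" "c \<in> A" "d \<in> B"
  shows "smooth_on (snd c ` (fst c \<inter> S \<inter> f -` fst d)) (local_rep c d f)"
  using assms by (auto simp: smooth_map_on_def local_rep_def split: prod.splits)

lemma smooth_map_onI:
  assumes "continuous_on S f"
    "\<And>c d. c \<in> A \<Longrightarrow> d \<in> B \<Longrightarrow> smooth_on (snd c ` (fst c \<inter> S \<inter> f -` fst d)) (local_rep c d f)"
  shows "smooth_map_on A B S f"
  unfolding smooth_map_on_def
proof (intro conjI ballI)
  fix x assume "x \<in> A"
  then show "case x of (U, \<phi>) \<Rightarrow> \<forall>(V, \<psi>)\<in>B. smooth_on (\<phi> ` (U \<inter> S \<inter> f -` V)) (\<psi> \<circ> f \<circ> inv_into U \<phi>)"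
    using assms(2) by (cases x) (force simp: local_rep_def)
qed (fact assms(1))

lemma smooth_map_on_continuous: "smooth_map_on A B S f \<Longrightarrow> continuous_on S f"
  by (simp add: smooth_map_on_def)

lemma smooth_domain_open:
  assumes "is_chart c" "is_chart d" "open S" "continuous_on S f"
  shows "open (snd c ` (fst c \<inter> S \<inter> f -` fst d))"
  using chart_image_open[OF assms(1) continuous_open_preimage[OF assms(4,3) is_chartD(1)[OF assms(2)]]]
  by (simp add: Int_assoc)

lemma smooth_map_on_subset:
  assumes "smooth_map_on A B S f" "T \<subseteq> S"
  shows "smooth_map_on A B T f"
proof (rule smooth_map_onI)
  show "continuous_on T f" using assms smooth_map_on_continuous continuous_on_subset by blast
  show "smooth_on (snd c ` (fst c \<inter> T \<inter> f -` fst d)) (local_rep c d f)" if "c \<in> A" "d \<in> B" for c d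
    by (rule smooth_on_subset[OF smooth_map_onD[OF assms(1) that]]) (use assms(2) in auto)
qed

text \<open>A single chart of the middle manifold need not contain the image, so the chart
  expression of the composite factors only locally; smoothness is checked on a neighbourhood
  \<open>Q\<close> of each point whose image lies in one chart \<open>d\<close>.\<close>

lemma smooth_map_on_compose:
  assumes A: "chart_cover A" and B: "chart_cover B" and C: "chart_cover C" 
    and "open S" "open T" "f ` S \<subseteq> T" and f: "smooth_map_on A B S f" and g: "smooth_map_on B C T g"
  shows "smooth_map_on A C S (\<lambda>x. g (f x))"
proof (rule smooth_map_onI)
  show "continuous_on S (\<lambda>x. g (f x))"
    by (rule continuous_on_compose2[OF smooth_map_on_continuous[OF g] smooth_map_on_continuous[OF f] assms(6)])
  fix c e assume c: "c \<in> A" and e: "e \<in> C"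
  note chc = chart_coverD[OF A c] and che = chart_coverD[OF C e]
  show "smooth_on (snd c ` (fst c \<inter> S \<inter> (\<lambda>x. g (f x)) -` fst e)) (local_rep c e (\<lambda>x. g (f x)))"
  proof (rule smooth_on_local)
    fix p assume "p \<in> snd c ` (fst c \<inter> S \<inter> (\<lambda>x. g (f x)) -` fst e)"
    then obtain x where x: "p = snd c x" "x \<in> fst c" "x \<in> S" "g (f x) \<in> fst e" by auto
    obtain d where d: "d \<in> B" "f x \<in> fst d" using chart_coverE[OF B] by metis
    note chd = chart_coverD[OF B d(1)]
    define T' where "T' = fst d \<inter> (T \<inter> g -` fst e)"
    have "open T'" unfolding T'_def
      by (intro open_Int is_chartD(1)[OF chd] continuous_open_preimage smooth_map_on_continuous[OF g] 
          assms(5) is_chartD(1)[OF che])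
    define Q where "Q = snd c ` (fst c \<inter> (S \<inter> f -` T'))"
    have "open Q" unfolding Q_def
      by (intro chart_image_open chc continuous_open_preimage smooth_map_on_continuous[OF f] assms(4) \<open>open T'\<close>)
    have "p \<in> Q" unfolding Q_def T'_def using x d assms(6) by auto
    have dT: "snd d ` T' = snd d ` (fst d \<inter> T \<inter> g -` fst e)" by (simp add: T'_def Int_assoc)
    have "smooth_on Q (\<lambda>p. local_rep d e g (local_rep c d f p))"
    proof (rule smooth_on_compose[OF \<open>open Q\<close>, where f = "local_rep c d f" and g = "local_rep d e g" and T = "snd d ` T'"])
      show "open (snd d ` T')" unfolding dT
        by (rule smooth_domain_open[OF chd che assms(5) smooth_map_on_continuous[OF g]])
      show "local_rep c d f ` Q \<subseteq> snd d ` T'"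
        using is_chartD(6)[OF chc] by (auto simp: Q_def local_rep_def)
      show "smooth_on (snd d ` T') (local_rep d e g)" unfolding dT
        by (rule smooth_map_onD[OF g d(1) e])
      show "smooth_on Q (local_rep c d f)"
        by (rule smooth_on_subset[OF smooth_map_onD[OF f c d(1)]]) (auto simp: Q_def T'_def)
    qed
    then have "smooth_on Q (local_rep c e (\<lambda>x. g (f x)))"
      by (rule smooth_on_cong[OF \<open>open Q\<close>])
        (use is_chartD(6)[OF chc] is_chartD(6)[OF chd] in \<open>auto simp: Q_def T'_def local_rep_def\<close>)
    with \<open>open Q\<close> \<open>p \<in> Q\<close> show "\<exists>T. open T \<and> p \<in> T \<and> smooth_on T (local_rep c e (\<lambda>x. g (f x)))"
      by blast
  qed
qed

lemma smooth_map_on_Pair: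
  assumes A: "chart_cover A" and B: "chart_cover B" and C: "chart_cover C" and "open S"
    and f: "smooth_map_on A B S f" and g: "smooth_map_on A C S g"
  shows "smooth_map_on A (product_atlas B C) S (\<lambda>x. (f x, g x))"
proof (rule smooth_map_onI)
  show "continuous_on S (\<lambda>x. (f x, g x))"
    by (intro continuous_on_Pair smooth_map_on_continuous[OF f] smooth_map_on_continuous[OF g])
  fix c e assume c: "c \<in> A" and "e \<in> product_atlas B C"
  then obtain d1 d2 where e: "e = (fst d1 \<times> fst d2, map_prod (snd d1) (snd d2))" "d1 \<in> B" "d2 \<in> C"
    by (auto simp: product_atlas_def)
  let ?Q = "snd c ` (fst c \<inter> S \<inter> (\<lambda>x. (f x, g x)) -` fst e)"
  have "open ((S \<inter> f -` fst d1) \<inter> (S \<inter> g -` fst d2))"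
    by (intro open_Int continuous_open_preimage smooth_map_on_continuous[OF f] smooth_map_on_continuous[OF g] assms(4)
        is_chartD(1) chart_coverD[OF B e(2)] chart_coverD[OF C e(3)])
  from chart_image_open[OF chart_coverD[OF A c] this]
  have "open ?Q" by (rule back_subst[where P = "open"]) (auto simp: e(1))
  have "smooth_on ?Q (\<lambda>p. (local_rep c d1 f p, local_rep c d2 g p))"
    by (intro smooth_on_Pair \<open>open ?Q\<close> smooth_on_subset[OF smooth_map_onD[OF f c e(2)]]
        smooth_on_subset[OF smooth_map_onD[OF g c e(3)]]) (auto simp: e(1))
  then show "smooth_on ?Q (local_rep c e (\<lambda>x. (f x, g x)))"
    by (rule smooth_on_cong[OF \<open>open ?Q\<close>]) (auto simp: e(1) local_rep_def)
qed

lemma smooth_map_on_const: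
  assumes "chart_cover A" "open S"
  shows "smooth_map_on A B S (\<lambda>x. y)"
proof (rule smooth_map_onI)
  fix c d assume cd: "c \<in> A" "d \<in> B"
  have "open (snd c ` (fst c \<inter> S \<inter> (\<lambda>x. y) -` fst d))"
    by (cases "y \<in> fst d") (auto simp: chart_image_open[OF chart_coverD[OF assms(1) cd(1)] assms(2)])
  from smooth_on_const[OF this, of "snd d y"]
  show "smooth_on (snd c ` (fst c \<inter> S \<inter> (\<lambda>x. y) -` fst d)) (local_rep c d (\<lambda>x. y))"
    unfolding local_rep_def comp_def .
qed simp

text \<open>The chart expressions of the identity are the transition maps, so this is exactly where
  compatibility of the atlas enters.\<close>

lemma smooth_map_on_id:
  assumes "smooth_atlas A"
  shows "smooth_map_on A A S (\<lambda>x. x)"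
proof -
  have "smooth_map_on A A UNIV (\<lambda>x. x)"
  proof (rule smooth_map_onI)
    fix c d assume "c \<in> A" "d \<in> A"
    then have "smooth_on (snd c ` (fst c \<inter> fst d)) (snd d \<circ> inv_into (fst c) (snd c))"
      using assms by (fastforce simp: smooth_atlas_def)
    then show "smooth_on (snd c ` (fst c \<inter> UNIV \<inter> (\<lambda>x. x) -` fst d)) (local_rep c d (\<lambda>x. x))"
      by (simp add: local_rep_def comp_def vimage_def)
  qed (rule continuous_on_id)
  then show ?thesis by (rule smooth_map_on_subset) simp
qed

lemma smooth_map_on_euclidean:
  assumes "smooth_on S f"
  shows "smooth_map_on euclidean_atlas euclidean_atlas S f"
  using assms smooth_on_continuous by (auto simp: smooth_map_on_def euclidean_atlas_def image_def)

lemma smooth_map_on_inv_chart: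
  assumes "smooth_atlas A" "c \<in> A"
  shows "smooth_map_on euclidean_atlas A (snd c ` fst c) (inv_into (fst c) (snd c))"
proof (rule smooth_map_onI)
  note ch = is_chartD[OF chart_coverD[OF smooth_atlas_cover[OF assms(1)] assms(2)]]
  show "continuous_on (snd c ` fst c) (inv_into (fst c) (snd c))" by (rule ch(5))
  fix e d assume e: "e \<in> (euclidean_atlas :: ('b, 'b) chart set)" and d: "d \<in> A"
  have eq: "snd c ` (fst c \<inter> UNIV \<inter> (\<lambda>x. x) -` fst d) = 
    snd e ` (fst e \<inter> snd c ` fst c \<inter> inv_into (fst c) (snd c) -` fst d)"
    using e ch(6) by (force simp: euclidean_atlas_def)
  show "smooth_on (snd e ` (fst e \<inter> snd c ` fst c \<inter> inv_into (fst c) (snd c) -` fst d)) 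
     (local_rep e d (inv_into (fst c) (snd c)))"
    using smooth_map_onD[OF smooth_map_on_id[OF assms(1)] assms(2) d, of UNIV] e unfolding eq
    by (simp add: local_rep_def comp_def euclidean_atlas_def)
qed

section \<open>Differentials and velocities in arbitrary charts\<close>

lemma local_rep_has_derivative:
  assumes "smooth_map_on A B S f" "c \<in> A" "d \<in> B" "x \<in> S" "x \<in> fst c" "f x \<in> fst d"
  shows "(local_rep c d f has_derivative diff_in c d f x) (at (snd c x))"
  unfolding diff_in_def
  by (rule smooth_on_has_derivative[OF smooth_map_onD[OF assms(1-3)]]) (use assms(4-) in auto)

lemma differential_diff_in: "differential A B f x = diff_in (chart_at A x) (chart_at B (f x)) f x"
  by (simp add: differential_def diff_in_def local_rep_def coord_at_def param_at_def)

lemma diff_in_compose: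
  assumes A: "chart_cover A" and B: "chart_cover B" and C: "chart_cover C" 
    and "open S" "open T" "f ` S \<subseteq> T" and f: "smooth_map_on A B S f" and g: "smooth_map_on B C T g"
    and c: "c \<in> A" "x \<in> fst c" "x \<in> S" and d: "d \<in> B" "f x \<in> fst d" and e: "e \<in> C" "g (f x) \<in> fst e"
  shows "diff_in c e (\<lambda>x. g (f x)) x v = diff_in d e g (f x) (diff_in c d f x v)"
proof -
  note chc = chart_coverD[OF A c(1)]
  have inv: "inv_into (fst c) (snd c) (snd c x) = x" by (rule is_chartD(6)[OF chc c(2)])
  have "(local_rep d e g has_derivative diff_in d e g (f x)) (at (local_rep c d f (snd c x)))"
    using local_rep_has_derivative[OF g d(1) e(1) _ d(2) e(2)] c(3) assms(6) inv by (auto simp: local_rep_def)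
  from has_derivative_compose[OF local_rep_has_derivative[OF f c(1) d(1) c(3) c(2) d(2)] this]
  have D: "((\<lambda>p. local_rep d e g (local_rep c d f p)) has_derivative (\<lambda>v. diff_in d e g (f x) (diff_in c d f x v))) (at (snd c x))" .
  define Q where "Q = snd c ` (fst c \<inter> (S \<inter> f -` fst d))"
  have "open Q" unfolding Q_def
    by (intro chart_image_open chc continuous_open_preimage smooth_map_on_continuous[OF f] assms(4)
        is_chartD(1) chart_coverD[OF B d(1)])
  have "(local_rep c e (\<lambda>x. g (f x)) has_derivative (\<lambda>v. diff_in d e g (f x) (diff_in c d f x v))) (at (snd c x))"
    by (rule has_derivative_transform_within_open[OF D \<open>open Q\<close>])
      (use c d is_chartD(6)[OF chart_coverD[OF B d(1)]] is_chartD(6)[OF chc] in \<open>auto simp: Q_def local_rep_def\<close>)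
  then show ?thesis unfolding diff_in_def using frechet_derivative_at by metis
qed

text \<open>The local representative describes \<open>f\<close> along \<open>\<gamma>\<close> only
  while \<open>\<gamma>\<close> stays in the chart \<open>c\<close>; continuity at \<open>t\<close>
  ensures this for nearby parameters, which suffices for a derivative within
  \<open>T\<close>.\<close>

lemma velocity_chain:
  assumes A: "chart_cover A" and B: "chart_cover B" and f: "smooth_map_on A B S f" 
    and "c \<in> A" "d \<in> B" "\<gamma> t \<in> S" "\<gamma> t \<in> fst c" "f (\<gamma> t) \<in> fst d"
    and cont: "continuous (at t within T) \<gamma>" and "t \<in> T"
    and v: "((\<lambda>s. snd c (\<gamma> s)) has_vector_derivative v) (at t within T)"
  shows "((\<lambda>s. snd d (f (\<gamma> s))) has_vector_derivative diff_in c d f (\<gamma> t) v) (at t within T)"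
proof -
  note ch = is_chartD[OF chart_coverD[OF A assms(4)]]
  have "((\<lambda>s. local_rep c d f (snd c (\<gamma> s))) has_vector_derivative diff_in c d f (\<gamma> t) v) (at t within T)"
    using has_derivative_compose[OF v[unfolded has_vector_derivative_def] local_rep_has_derivative[OF f assms(4-8)]]
      linear_cmul[OF has_derivative_linear[OF local_rep_has_derivative[OF f assms(4-8)]]]
    by (simp add: has_vector_derivative_def)
  moreover have "\<forall>\<^sub>F s in at t within T. \<gamma> s \<in> fst c"
    using cont ch(1) assms(7) by (auto simp: continuous_within dest: topological_tendstoD)
  then have "\<forall>\<^sub>F s in at t within T. local_rep c d f (snd c (\<gamma> s)) = snd d (f (\<gamma> s))"
    by eventually_elim (simp add: local_rep_def ch(6))
  ultimately show ?thesis
    unfolding has_vector_derivative_def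
    by (rule has_derivative_transform_eventually) (use assms ch(6) in \<open>auto simp: local_rep_def\<close>)
qed

text \<open>Joint smoothness in both coordinates makes the derivative in the second variable depend
  smoothly on the first. This controls differentials of translations as the group element varies,
  and the left-invariant vector fields.\<close>

lemma smooth_two_variables:
  assumes A: "chart_cover A" and B: "chart_cover B" and C: "chart_cover C" 
    and m: "smooth_map (product_atlas A B) C m" and c: "c \<in> A" and d: "d \<in> B" and e: "e \<in> C"
  defines "\<Omega> \<equiv> {(p, q). p \<in> snd c ` fst c \<and> q \<in> snd d ` fst d \<and> 
      m (inv_into (fst c) (snd c) p, inv_into (fst d) (snd d) q) \<in> fst e}"
  shows "open \<Omega>" 
    and "smooth_on \<Omega> (\<lambda>z. snd e (m (inv_into (fst c) (snd c) (fst z), inv_into (fst d) (snd d) (snd z))))"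
proof -
  note chc = is_chartD[OF chart_coverD[OF A c]] and chd = is_chartD[OF chart_coverD[OF B d]]
  let ?cd = "(fst c \<times> fst d, map_prod (snd c) (snd d))"
  have cd: "?cd \<in> product_atlas A B" using c d by (cases c; cases d) (auto simp: product_atlas_def)
  have eq: "snd ?cd ` (fst ?cd \<inter> UNIV \<inter> m -` fst e) = \<Omega>" (is "?L = _")
  proof
    show "?L \<subseteq> \<Omega>" using chc(6) chd(6) by (auto simp: \<Omega>_def)
    show "\<Omega> \<subseteq> ?L"
    proof clarify
      fix p q assume "(p, q) \<in> \<Omega>"
      then show "(p, q) \<in> ?L" unfolding \<Omega>_def
        by (auto intro!: image_eqI[of _ _ "(inv_into (fst c) (snd c) p, inv_into (fst d) (snd d) q)"]
            simp: f_inv_into_f inv_into_into)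
    qed
  qed
  show "open \<Omega>" unfolding eq[symmetric]
    by (rule smooth_domain_open[OF chart_coverD[OF chart_cover_product[OF A B] cd] chart_coverD[OF C e] open_UNIV
        smooth_map_on_continuous[OF m]])
  from smooth_map_onD[OF m cd e, unfolded eq]
  show "smooth_on \<Omega> (\<lambda>z. snd e (m (inv_into (fst c) (snd c) (fst z), inv_into (fst d) (snd d) (snd z))))"
    by (rule smooth_on_cong[OF \<open>open \<Omega>\<close>]) (auto simp: \<Omega>_def local_rep_def inv_into_map_prod[OF chc(3) chd(3)])
qed

section \<open>Smooth group actions\<close>

lemma chart_cover_locally_compact:
  fixes A :: "('m::topological_space, 'e::euclidean_space) chart set" and x :: 'm
  assumes "chart_cover A" "open N" "x \<in> N"
  obtains W C where "open W" "compact C" "x \<in> W" "W \<subseteq> C" "C \<subseteq> N"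
proof -
  obtain c where c: "c \<in> A" "x \<in> fst c" using chart_coverE[OF assms(1)] by metis
  note chc = chart_coverD[OF assms(1) c(1)] and ch = is_chartD[OF chart_coverD[OF assms(1) c(1)]]
  have "open (snd c ` (fst c \<inter> N))" by (rule chart_image_open[OF chc assms(2)])
  then obtain r where r: "r > 0" "cball (snd c x) r \<subseteq> snd c ` (fst c \<inter> N)"
    using open_contains_cball c(2) assms(3) by blast
  show thesis
  proof (rule that)
    show "open (fst c \<inter> snd c -` ball (snd c x) r)"
      by (rule continuous_open_preimage[OF ch(4,1) open_ball])
    show "compact (inv_into (fst c) (snd c) ` cball (snd c x) r)"
      using r by (intro compact_continuous_image continuous_on_subset[OF ch(5)] compact_cball) auto
    show "x \<in> fst c \<inter> snd c -` ball (snd c x) r" using c r by simp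
    show "fst c \<inter> snd c -` ball (snd c x) r \<subseteq> inv_into (fst c) (snd c) ` cball (snd c x) r"
    proof
      fix z assume "z \<in> fst c \<inter> snd c -` ball (snd c x) r"
      then show "z \<in> inv_into (fst c) (snd c) ` cball (snd c x) r"
        using ch(6)[of z] by (intro image_eqI[of _ _ "snd c z"]) auto
    qed
    show "inv_into (fst c) (snd c) ` cball (snd c x) r \<subseteq> N"
    proof clarify
      fix p assume "p \<in> cball (snd c x) r"
      then obtain z where "p = snd c z" "z \<in> fst c" "z \<in> N" using r(2) by auto
      then show "inv_into (fst c) (snd c) p \<in> N" using ch(6) by simp
    qed
  qed
qed

section \<open>Baire's theorem and openness of the orbit map\<close>

text \<open>The type of points carries no complete metric, so the version of Baire's theorem for
  locally compact regular spaces is used; regularity follows from local compactness and the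
  Hausdorff property.\<close>

lemma locally_compact_Baire:
  fixes \<G> :: "'m::t2_space set set"
  assumes "chart_cover (A :: ('m, 'e::euclidean_space) chart set)"
    and "countable \<G>" "\<And>T. T \<in> \<G> \<Longrightarrow> closed T" "\<Union>\<G> = UNIV"
  obtains T where "T \<in> \<G>" "interior T \<noteq> {}"
proof -
  note witness = that
  have lc: "locally_compact_space (euclidean :: 'm topology)"
    unfolding locally_compact_space_def
  proof
    fix x :: 'm
    obtain W C where "open W" "compact C" "x \<in> W" "W \<subseteq> C" 
      using chart_cover_locally_compact[OF assms(1) open_UNIV UNIV_I] by metis
    then show "\<exists>U K. openin euclidean U \<and> compactin euclidean K \<and> x \<in> U \<and> U \<subseteq> K"
      by (auto simp: compactin_euclidean_iff)
  qed
  moreover have "Hausdorff_space (euclidean :: 'm topology)"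
    unfolding Hausdorff_space_def by (simp add: disjnt_def) (metis hausdorff)
  ultimately have reg: "regular_space (euclidean :: 'm topology)"
    using locally_compact_Hausdorff_imp_regular_space by blast
  show thesis
  proof (rule ccontr)
    assume "\<not> thesis"
    then have "closedin euclidean T \<and> euclidean interior_of T = {}" if "T \<in> \<G>" for T
      using witness[OF that] assms(3)[OF that] by auto
    from Baire_category_alt[OF disjI2[OF conjI[OF lc reg]] assms(2) this]
    show False using assms(4) by simp
  qed
qed

locale lie_action =
  fixes G :: "('g::{t2_space, second_countable_topology}) monoid" (structure)
    and B :: "('g, 'd::euclidean_space) chart set"
    and A :: "('m::{t2_space, second_countable_topology}, 'e::euclidean_space) chart set"
    and \<tau> :: "'g \<Rightarrow> 'm \<Rightarrow> 'm"
  assumes lie: "lie_group G B" and atlas: "smooth_atlas A"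
    and smooth_action: "smooth_map (product_atlas B A) A (\<lambda>(g, x). \<tau> g x)"
    and act_one: "\<tau> \<one> x = x"
    and act_mult: "\<tau> (g \<otimes> h) x = \<tau> g (\<tau> h x)"
begin

sublocale group G using lie by (simp add: lie_group_def)

lemma carrier_UNIV [simp]: "carrier G = UNIV" using lie by (simp add: lie_group_def)

lemma coverA: "chart_cover A" using atlas smooth_atlas_cover by blast
lemma atlasB: "smooth_atlas B" using lie by (simp add: lie_group_def)
lemma coverB: "chart_cover B" using atlasB smooth_atlas_cover by blast

lemma act_inv [simp]: "\<tau> (inv g) (\<tau> g x) = x" "\<tau> g (\<tau> (inv g) x) = x"
  by (simp_all flip: act_mult add: act_one)

lemma continuous_action: "continuous_on UNIV (\<lambda>(g, x). \<tau> g x)"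
  by (rule smooth_map_on_continuous[OF smooth_action])

lemma continuous_division: "continuous_on UNIV (\<lambda>(g, h). inv g \<otimes> h)"
proof -
  have m: "continuous_on UNIV (\<lambda>(g, h). g \<otimes> h)" and i: "continuous_on UNIV (\<lambda>g. inv g)"
    using lie smooth_map_on_continuous unfolding lie_group_def by blast+
  have "continuous_on UNIV (\<lambda>z. (\<lambda>(g, h). g \<otimes> h) (inv (fst z), snd z))"
    by (intro continuous_on_compose2[OF m] continuous_on_Pair continuous_on_compose2[OF i] continuous_intros) auto
  then show ?thesis by (simp add: case_prod_unfold)
qed

lemma smooth_translation: "smooth_map A A (\<tau> g)"
proof -
  have "smooth_map_on A (product_atlas B A) UNIV (\<lambda>x. (g, x))"
    by (intro smooth_map_on_Pair coverA coverB smooth_map_on_const smooth_map_on_id atlas open_UNIV)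
  from smooth_map_on_compose[OF coverA chart_cover_product[OF coverB coverA] coverA open_UNIV open_UNIV _ this smooth_action]
  show ?thesis by simp
qed

lemma smooth_orbit_map: "smooth_map B A (\<lambda>g. \<tau> g x)"
proof -
  have "smooth_map_on B (product_atlas B A) UNIV (\<lambda>g. (g, x))"
    by (intro smooth_map_on_Pair coverA coverB smooth_map_on_const smooth_map_on_id atlasB open_UNIV)
  from smooth_map_on_compose[OF coverB chart_cover_product[OF coverB coverA] coverA open_UNIV open_UNIV _ this smooth_action]
  show ?thesis by simp
qed

lemma continuous_translation: "continuous_on UNIV (\<tau> g)"
  by (rule smooth_map_on_continuous[OF smooth_translation])

lemma continuous_orbit_map: "continuous_on UNIV (\<lambda>g. \<tau> g x)"
  by (rule smooth_map_on_continuous[OF smooth_orbit_map])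

text \<open>The group acting on itself: left translations thereby inherit the facts about
  translations of a general action, in particular the estimate near the identity.\<close>

lemma regular_action: "lie_action G B B (\<lambda>g h. g \<otimes> h)"
  using lie atlasB by unfold_locales (auto simp: lie_group_def m_assoc)

text \<open>Prepares the return step of the Baire argument: two elements of \<open>C\<close> will
  differ by a quotient that has to lie in \<open>N\<close>. Compactness of \<open>C\<close> makes
  its translated orbits closed.\<close>

lemma division_nbhd:
  assumes "open N" "\<one> \<in> N"
  obtains W C where "open W" "compact C" "\<one> \<in> W" "W \<subseteq> C" "\<And>g h. g \<in> C \<Longrightarrow> h \<in> C \<Longrightarrow> inv g \<otimes> h \<in> N"
proof -
  have "open ((\<lambda>(g, h). inv g \<otimes> h) -` N)"
    using open_vimage[OF assms(1) continuous_division] .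
  then obtain P Q where PQ: "open P" "open Q" "(\<one>, \<one>) \<in> P \<times> Q" "P \<times> Q \<subseteq> (\<lambda>(g, h). inv g \<otimes> h) -` N"
    using assms(2) by (elim open_prod_elim[of _ "(\<one>, \<one>)"]) auto
  obtain W C where W: "open W" "compact C" "\<one> \<in> W" "W \<subseteq> C" "C \<subseteq> P \<inter> Q"
    using chart_cover_locally_compact[OF coverB, of "P \<inter> Q" \<one>] PQ by auto
  show thesis
  proof (rule that[OF W(1-4)])
    fix g h assume "g \<in> C" "h \<in> C"
    then have "(g, h) \<in> P \<times> Q" using W(5) by blast
    then have "(g, h) \<in> (\<lambda>(g, h). inv g \<otimes> h) -` N" using PQ(4) by blast
    then show "inv g \<otimes> h \<in> N" by simp
  qed
qed

end

locale lie_homogeneous = lie_action +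
  assumes transitive: "\<exists>g. \<tau> g x = y"
begin

text \<open>Countably many translates \<open>P i\<close> of \<open>W\<close> cover the group, so
  countably many compact sets \<open>T i\<close> cover the manifold, and some \<open>T i\<close> has
  an interior point \<open>\<tau> i (\<tau> w x)\<close> with \<open>w\<close> in \<open>C\<close>.
  Moving this point back to \<open>x\<close> turns elements \<open>h\<close> of \<open>C\<close>
  into quotients \<open>inv w \<otimes> h\<close>, which lie in \<open>N\<close>.\<close>

lemma orbit_nbhd:
  assumes "open N" "\<one> \<in> N"
  obtains T where "open T" "x \<in> T" "T \<subseteq> (\<lambda>g. \<tau> g x) ` N"
proof -
  obtain W C where W: "open W" "compact C" "\<one> \<in> W" "W \<subseteq> C" 
    and C: "\<And>g h. g \<in> C \<Longrightarrow> h \<in> C \<Longrightarrow> inv g \<otimes> h \<in> N"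
    using division_nbhd[OF assms] by metis
  define P where "P g = {h. inv g \<otimes> h \<in> W}" for g
  have openP: "open (P g)" for g
  proof -
    have "continuous_on UNIV (\<lambda>h. (\<lambda>(g, h). inv g \<otimes> h) (g, h))"
      by (intro continuous_on_compose2[OF continuous_division] continuous_intros) auto
    then show ?thesis using open_vimage[OF W(1)] by (simp add: P_def vimage_def)
  qed
  \<comment> \<open>Second countability of the group enters here, through Lindelof's
    theorem.\<close>
  obtain \<F> where \<F>: "\<F> \<subseteq> range P" "countable \<F>" "\<Union>\<F> = \<Union>(range P)"
    by (rule Lindelof[of "range P"]) (use openP in blast)+
  then obtain I where I: "countable I" "\<F> = P ` I" using \<F>(1,2) countable_subset_image[of \<F> P UNIV] by auto
  have gP: "g \<in> P g" for g using W(3) by (simp add: P_def)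
  define T where "T i = \<tau> i ` (\<lambda>h. \<tau> h x) ` C" for i
  have "compact (T i)" for i unfolding T_def
    by (intro compact_continuous_image W(2) continuous_on_subset[OF continuous_translation]
        continuous_on_subset[OF continuous_orbit_map]) auto
  then have closedT: "closed (T i)" for i by (rule compact_imp_closed)
  have T_UNIV: "\<Union>(T ` I) = UNIV"
  proof -
    have "y \<in> \<Union>(T ` I)" for y
    proof -
      obtain g where g: "\<tau> g x = y" using transitive by metis
      have "g \<in> \<Union>\<F>" unfolding \<F>(3) by (rule UN_I, rule UNIV_I, rule gP)
      then obtain i where "i \<in> I" "inv i \<otimes> g \<in> C" using I(2) W(4) by (auto simp: P_def)
      moreover have "y = \<tau> i (\<tau> (inv i \<otimes> g) x)" by (simp add: act_mult g)
      ultimately show ?thesis by (auto simp: T_def)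
    qed
    then show ?thesis by blast
  qed
  obtain i where "interior (T i) \<noteq> {}"
    by (rule locally_compact_Baire[OF coverA countable_image[OF I(1)] _ T_UNIV]) (use closedT in auto)
  then obtain z where z: "z \<in> interior (T i)" by blast
  then obtain w where w: "w \<in> C" "z = \<tau> i (\<tau> w x)" using interior_subset by (auto simp: T_def)
  show thesis
  proof (rule that)
    show "open (\<tau> (i \<otimes> w) -` interior (T i))"
      by (rule open_vimage[OF open_interior continuous_translation])
    show "x \<in> \<tau> (i \<otimes> w) -` interior (T i)" using z w by (simp add: act_mult)
    show "\<tau> (i \<otimes> w) -` interior (T i) \<subseteq> (\<lambda>g. \<tau> g x) ` N"
    proof
      fix y assume "y \<in> \<tau> (i \<otimes> w) -` interior (T i)"
      then have "\<tau> (i \<otimes> w) y \<in> T i" using interior_subset by blast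
      then obtain h where h: "h \<in> C" "\<tau> i (\<tau> w y) = \<tau> i (\<tau> h x)" by (auto simp: T_def act_mult)
      then have "y = \<tau> (inv w \<otimes> h) x" by (metis act_inv(1) act_mult)
      then show "y \<in> (\<lambda>g. \<tau> g x) ` N" using C[OF w(1) h(1)] by blast
    qed
  qed
qed

end

section \<open>Differentials of translations near the identity\<close>

context lie_action
begin

text \<open>Seen as a partial derivative of the joint chart expression \<open>M\<close>, the
  differential of \<open>\<tau> g\<close> depends smoothly on the coordinates of
  \<open>g\<close>.\<close>

lemma translation_derivative:
  assumes b: "b \<in> B" "g \<in> fst b" and c: "c \<in> A" "y \<in> fst c" and d: "d \<in> A" "\<tau> g y \<in> fst d"
  defines "M \<equiv> (\<lambda>z. snd d (\<tau> (inv_into (fst b) (snd b) (fst z)) (inv_into (fst c) (snd c) (snd z))))"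
  shows "diff_in c d (\<tau> g) y v = frechet_derivative M (at (snd b g, snd c y)) (0, v)"
proof -
  note chb = is_chartD[OF chart_coverD[OF coverB b(1)]] and chc = is_chartD[OF chart_coverD[OF coverA c(1)]]
  have "(M has_derivative frechet_derivative M (at (snd b g, snd c y))) (at (snd b g, snd c y))"
    using smooth_on_has_derivative[OF smooth_two_variables(2)[OF coverB coverA coverA smooth_action b(1) c(1) d(1)]]
      b c d chb(6) chc(6) by (simp add: M_def)
  from has_derivative_compose[OF has_derivative_Pair[OF has_derivative_const has_derivative_ident] this]
  have "((\<lambda>q. M (snd b g, q)) has_derivative (\<lambda>v. frechet_derivative M (at (snd b g, snd c y)) (0, v))) (at (snd c y))"
    by simp
  moreover have "(\<lambda>q. M (snd b g, q)) = local_rep c d (\<tau> g)"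
    using chb(6)[OF b(2)] by (auto simp: M_def local_rep_def)
  ultimately show ?thesis
    unfolding diff_in_def using frechet_derivative_at by metis
qed

lemma translation_derivative_one:
  assumes "c \<in> A" "y \<in> fst c"
  shows "diff_in c c (\<tau> \<one>) y v = v"
proof -
  note ch = is_chartD[OF chart_coverD[OF coverA assms(1)]]
  have "frechet_derivative (local_rep c c (\<tau> \<one>)) (at (snd c y)) = frechet_derivative (\<lambda>x. x) (at (snd c y))"
    by (rule frechet_derivative_cong_open[OF ch(2)])
     (use assms ch(6) in \<open>auto simp: local_rep_def act_one\<close>)
  then show ?thesis by (simp add: diff_in_def frechet_derivative_ident)
qed

text \<open>For each fixed vector the differential varies continuously with \<open>g\<close>, and it
  is the identity at \<open>\<one>\<close>. Intersecting the neighbourhoods for the finitely many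
  basis vectors makes the estimate uniform in \<open>v\<close>; dividing \<epsilon> by
  \<open>DIM('e)\<close> pays for the sum over the basis.\<close>

lemma translation_derivative_near_one:
  assumes c: "c \<in> A" "y \<in> fst c" and "\<epsilon> > 0"
  obtains N where "open N" "\<one> \<in> N" "\<And>g. g \<in> N \<Longrightarrow> \<tau> g y \<in> fst c"
    "\<And>g v. g \<in> N \<Longrightarrow> norm (diff_in c c (\<tau> g) y v - v) \<le> \<epsilon> * norm v"
proof -
  note ch = is_chartD[OF chart_coverD[OF coverA c(1)]]
  obtain b where b: "b \<in> B" "\<one> \<in> fst b" using chart_coverE[OF coverB] by metis
  note chb = is_chartD[OF chart_coverD[OF coverB b(1)]]
  define M where "M = (\<lambda>z. snd c (\<tau> (inv_into (fst b) (snd b) (fst z)) (inv_into (fst c) (snd c) (snd z))))"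
  define \<Omega> where "\<Omega> = {(p, q). p \<in> snd b ` fst b \<and> q \<in> snd c ` fst c \<and> 
      (\<lambda>(g, x). \<tau> g x) (inv_into (fst b) (snd b) p, inv_into (fst c) (snd c) q) \<in> fst c}"
  note M = smooth_two_variables[OF coverB coverA coverA smooth_action b(1) c(1) c(1), folded \<Omega>_def]
  define P where "P = fst b \<inter> (\<lambda>g. \<tau> g y) -` fst c"
  have P: "open P" "\<one> \<in> P"
    unfolding P_def using b c open_vimage[OF ch(1) continuous_orbit_map] chb(1) by (auto simp: act_one)
  have T: "diff_in c c (\<tau> g) y v = frechet_derivative M (at (snd b g, snd c y)) (0, v)" if "g \<in> P" for g v
    unfolding M_def by (rule translation_derivative) (use that b c in \<open>auto simp: P_def\<close>)
  have "\<exists>N. open N \<and> \<one> \<in> N \<and> N \<subseteq> P \<and> (\<forall>g\<in>N. norm (diff_in c c (\<tau> g) y e - e) < \<epsilon> / DIM('e))" for e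
  proof -
    have "continuous_on \<Omega> (\<lambda>z. frechet_derivative M (at z) (0, e))"
      using smooth_on_continuous[OF smooth_on_derivative[OF M(2)]] by (simp add: M_def)
    then have "continuous_on P (\<lambda>g. frechet_derivative M (at (snd b g, snd c y)) (0, e))"
      by (rule continuous_on_compose2)
        (use chb ch c in \<open>auto simp: P_def \<Omega>_def intro!: continuous_on_Pair continuous_on_subset[OF chb(4)]\<close>)
    then have "continuous_on P (\<lambda>g. norm (diff_in c c (\<tau> g) y e - e))"
      by (intro continuous_intros) (simp add: T cong: continuous_on_cong)
    from continuous_open_preimage[OF this P(1) open_lessThan, of "\<epsilon> / DIM('e)"]
    show ?thesis
      by (intro exI[of _ "P \<inter> (\<lambda>g. norm (diff_in c c (\<tau> g) y e - e)) -` {..<\<epsilon> / DIM('e)}"])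
        (use P \<open>\<epsilon> > 0\<close> translation_derivative_one[OF c] in auto)
  qed
  then obtain N where N: "\<And>e. open (N e)" "\<And>e. \<one> \<in> N e" "\<And>e. N e \<subseteq> P"
    "\<And>e g. g \<in> N e \<Longrightarrow> norm (diff_in c c (\<tau> g) y e - e) < \<epsilon> / DIM('e)" by metis
  show thesis
  proof (rule that)
    show "open (\<Inter>e\<in>Basis. N e)" "\<one> \<in> (\<Inter>e\<in>Basis. N e)" using N by auto
    fix g assume g: "g \<in> (\<Inter>e\<in>Basis. N e)"
    obtain e0 :: 'e where "e0 \<in> Basis" using nonempty_Basis by blast
    with g N(3) have "g \<in> P" by blast
    then show "\<tau> g y \<in> fst c" by (simp add: P_def)
    then have lin: "linear (diff_in c c (\<tau> g) y)"
      using has_derivative_linear[OF local_rep_has_derivative[OF smooth_translation c(1) c(1) UNIV_I c(2)]] by blast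
    fix v
    have "diff_in c c (\<tau> g) y v - v = (\<Sum>e\<in>Basis. (v \<bullet> e) *\<^sub>R (diff_in c c (\<tau> g) y e)) - (\<Sum>e\<in>Basis. (v \<bullet> e) *\<^sub>R e)"
      using linear_expansion[OF lin, of v] by (simp add: euclidean_representation)
    also have "\<dots> = (\<Sum>e\<in>Basis. (v \<bullet> e) *\<^sub>R (diff_in c c (\<tau> g) y e - e))"
      by (simp add: sum_subtractf scaleR_diff_right)
    also have "norm \<dots> \<le> (\<Sum>e\<in>(Basis :: 'e set). norm v * (\<epsilon> / DIM('e)))"
    proof (rule sum_norm_le)
      fix e :: 'e assume e: "e \<in> Basis"
      have "\<bar>v \<bullet> e\<bar> * norm (diff_in c c (\<tau> g) y e - e) \<le> norm v * (\<epsilon> / DIM('e))"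
        using N(4)[of g e] g e by (intro mult_mono Basis_le_norm) auto
      then show "norm ((v \<bullet> e) *\<^sub>R (diff_in c c (\<tau> g) y e - e)) \<le> norm v * (\<epsilon> / DIM('e))" by simp
    qed
    also have "\<dots> = \<epsilon> * norm v" by simp
    finally show "norm (diff_in c c (\<tau> g) y v - v) \<le> \<epsilon> * norm v" .
  qed
qed

end

section \<open>Invariant cone fields\<close>

text \<open>Separating \<open>w\<close> from \<open>K\<close> directly would only yield a functional
  that is nonnegative on \<open>K\<close>. Strict positivity comes from separating 0 from the
  compact convex hull of \<open>- w\<close> and the unit vectors of \<open>K\<close>; pointedness
  keeps 0 out of the hull of those unit vectors.\<close>

lemma convex_cone_separation:
  fixes K :: "'a::euclidean_space set"
  assumes "closed K" "convex_cone K" "K \<inter> uminus ` K = {0}" "w \<notin> K"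
  obtains l where "\<And>k. k \<in> K \<Longrightarrow> k \<noteq> 0 \<Longrightarrow> l \<bullet> k > 0" "l \<bullet> w < 0"
proof -
  note scale = convex_cone_scaleR[OF assms(2)] and add = convex_cone_add[OF assms(2)]
  have "0 \<in> K" using assms(2) by (rule convex_cone_contains_0)
  define S where "S = K \<inter> sphere 0 1"
  have "compact S" unfolding S_def using assms(1) by (intro closed_Int_compact) auto
  have "convex (K - {0})"
    unfolding convex_def
  proof (intro ballI allI impI)
    fix x y and u v :: real
    assume *: "x \<in> K - {0}" "y \<in> K - {0}" "0 \<le> u" "0 \<le> v" "u + v = 1"
    have K: "u *\<^sub>R x \<in> K" "v *\<^sub>R y \<in> K" using * scale by auto
    have "u *\<^sub>R x + v *\<^sub>R y \<noteq> 0"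
    proof
      assume "u *\<^sub>R x + v *\<^sub>R y = 0"
      then have eq: "u *\<^sub>R x = - (v *\<^sub>R y)" by (simp add: eq_neg_iff_add_eq_0)
      then have "u *\<^sub>R x \<in> K \<inter> uminus ` K" using K by blast
      then have "u *\<^sub>R x = 0" "v *\<^sub>R y = 0" using assms(3) eq by auto
      then show False using * by auto
    qed
    then show "u *\<^sub>R x + v *\<^sub>R y \<in> K - {0}" using add[OF K] by simp
  qed
  then have hull: "convex hull S \<subseteq> K - {0}" by (intro hull_minimal) (auto simp: S_def)
  define H where "H = convex hull (insert (- w) S)"
  \<comment> \<open>A vanishing convex combination would make \<open>w\<close> a nonnegative
    multiple of an element of \<open>K\<close>. If \<open>S\<close> is empty, \<open>H\<close>
    consists of \<open>- w\<close> alone.\<close>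
  have "0 \<notin> H"
  proof
    assume "0 \<in> H"
    show False
    proof (cases "S = {}")
      case True
      then have "w = 0" using \<open>0 \<in> H\<close> by (simp add: H_def)
      then show False using \<open>0 \<in> K\<close> assms(4) by simp
    next
      case False
      then obtain u v b where *: "u \<ge> 0" "v \<ge> 0" "u + v = 1" "b \<in> convex hull S" "0 = u *\<^sub>R (- w) + v *\<^sub>R b"
        using \<open>0 \<in> H\<close> by (auto simp: H_def convex_hull_insert)
      have b: "b \<in> K" "b \<noteq> 0" using hull *(4) by auto
      have eq: "u *\<^sub>R w = v *\<^sub>R b" using *(5) by (simp add: algebra_simps)
      have "u \<noteq> 0" using eq b *(3) by auto
      then have "w = (v / u) *\<^sub>R b" using eq by (metis divide_inverse_commute inverse_eq_divide real_vector_eq_affinity vector_fraction_eq_iff)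
      then show False using scale[OF _ b(1), of "v / u"] * assms(4) by simp
    qed
  qed
  moreover have "closed H" unfolding H_def
    by (intro compact_imp_closed compact_convex_hull compact_insert \<open>compact S\<close>)
  moreover have "convex H" unfolding H_def by (rule convex_convex_hull)
  ultimately obtain l b where l: "b > 0" "\<And>x. x \<in> H \<Longrightarrow> l \<bullet> x > b"
    using separating_hyperplane_closed_0[of H] by blast
  show thesis
  proof (rule that)
    have "- w \<in> H" unfolding H_def by (rule hull_inc) simp
    from l(2)[OF this] l(1) show "l \<bullet> w < 0" by simp
    fix k assume k: "k \<in> K" "k \<noteq> 0"
    then have "(1 / norm k) *\<^sub>R k \<in> S" using scale[of "1 / norm k" k] by (simp add: S_def)
    then have "(1 / norm k) *\<^sub>R k \<in> H" unfolding H_def by (intro hull_inc) simp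
    from l(2)[OF this] l(1) have "0 < (1 / norm k) * (l \<bullet> k)" by simp
    then show "l \<bullet> k > 0" using k by (simp add: zero_less_divide_iff)
  qed
qed

text \<open>The minimum over the compact set of unit vectors of the cone, extended by homogeneity.
  The margin \<open>m\<close> is what absorbs a small perturbation of the cone.\<close>

lemma positive_functional_bound:
  fixes K :: "'a::euclidean_space set"
  assumes "closed K" "convex_cone K" "\<And>k. k \<in> K \<Longrightarrow> k \<noteq> 0 \<Longrightarrow> l \<bullet> k > 0"
  obtains m where "m > 0" "\<And>k. k \<in> K \<Longrightarrow> l \<bullet> k \<ge> m * norm k"
proof -
  define S where "S = K \<inter> sphere 0 1"
  have S: "compact S" unfolding S_def using assms(1) by (intro closed_Int_compact) auto
  obtain m where m: "m > 0" "\<And>s. s \<in> S \<Longrightarrow> l \<bullet> s \<ge> m"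
  proof (cases "S = {}")
    case True
    then show thesis using that[of 1] by auto
  next
    case False
    have "continuous_on S (\<lambda>s. l \<bullet> s)" by (intro continuous_intros)
    from continuous_attains_inf[OF S False this]
    obtain s where "s \<in> S" "\<And>s'. s' \<in> S \<Longrightarrow> l \<bullet> s \<le> l \<bullet> s'" by blast
    moreover from this have "s \<in> K" "s \<noteq> 0" by (auto simp: S_def)
    ultimately show thesis using that[of "l \<bullet> s"] assms(3)[of s] by blast
  qed
  have "l \<bullet> k \<ge> m * norm k" if "k \<in> K" for k
  proof (cases "k = 0")
    case False
    then have "(1 / norm k) *\<^sub>R k \<in> S"
      using convex_cone_scaleR[OF assms(2), of "1 / norm k" k] that by (simp add: S_def)
    from m(2)[OF this] show ?thesis using False by (simp add: field_simps)
  qed simp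
  with m(1) show thesis using that by blast
qed

section \<open>Velocities of curves in a fixed chart\<close>

lemma has_velocity_within_iff:
  "has_velocity_within A \<gamma> v t T \<longleftrightarrow> ((\<lambda>s. snd (chart_at A (\<gamma> t)) (\<gamma> s)) has_vector_derivative v) (at t within T)"
  by (simp add: has_velocity_within_def coord_at_def comp_def)

text \<open>Velocities are recorded in a chart that depends on the point of the curve, so their
  continuity in time makes sense only after they are read in one chart \<open>c\<close>.\<close>

lemma smooth_curve_derivative:
  assumes A: "chart_cover A" and \<delta>: "smooth_map_on euclidean_atlas A W \<delta>" and "open W" and c: "c \<in> A"
  obtains V where "continuous_on {t\<in>W. \<delta> t \<in> fst c} V"
    "\<And>t. t \<in> W \<Longrightarrow> \<delta> t \<in> fst c \<Longrightarrow> ((\<lambda>s. snd c (\<delta> s)) has_vector_derivative V t) (at t)"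
proof -
  let ?E = "(UNIV, id) :: (real, real) chart"
  have E: "?E \<in> euclidean_atlas" by (simp add: euclidean_atlas_def)
  have rep: "local_rep ?E c \<delta> = (\<lambda>s. snd c (\<delta> s))"
    by (auto simp: local_rep_def inv_into_def id_def)
  have sm: "smooth_on {t\<in>W. \<delta> t \<in> fst c} (\<lambda>s. snd c (\<delta> s))"
    using smooth_map_onD[OF \<delta> E c] unfolding rep by (simp add: Collect_conj_eq vimage_def)
  show thesis
  proof (rule that)
    show "continuous_on {t\<in>W. \<delta> t \<in> fst c} (\<lambda>t. frechet_derivative (\<lambda>s. snd c (\<delta> s)) (at t) 1)"
      by (rule smooth_on_continuous[OF smooth_on_derivative[OF sm]])
    fix t assume "t \<in> W" "\<delta> t \<in> fst c"
    then have D: "((\<lambda>s. snd c (\<delta> s)) has_derivative frechet_derivative (\<lambda>s. snd c (\<delta> s)) (at t)) (at t)"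
      by (intro smooth_on_has_derivative[OF sm]) simp
    have "frechet_derivative (\<lambda>s. snd c (\<delta> s)) (at t) x = x *\<^sub>R frechet_derivative (\<lambda>s. snd c (\<delta> s)) (at t) 1" for x
      using linear_cmul[OF has_derivative_linear[OF D], of x 1] by simp
    then show "((\<lambda>s. snd c (\<delta> s)) has_vector_derivative frechet_derivative (\<lambda>s. snd c (\<delta> s)) (at t) 1) (at t)"
      unfolding has_vector_derivative_def by (intro has_derivative_eq_rhs[OF D] ext)
  qed
qed

lemma velocity_change_chart:
  assumes "smooth_atlas A" "c \<in> A" "\<gamma> t \<in> fst c" "continuous (at t within T) \<gamma>" "t \<in> T" 
    and "has_velocity_within A \<gamma> v t T"
  shows "((\<lambda>s. snd c (\<gamma> s)) has_vector_derivative diff_in (chart_at A (\<gamma> t)) c (\<lambda>x. x) (\<gamma> t) v) (at t within T)"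
proof -
  note cov = smooth_atlas_cover[OF assms(1)]
  show ?thesis
    by (rule velocity_chain[OF cov cov smooth_map_on_id[OF assms(1)] chart_at_in(1)[OF cov] assms(2) UNIV_I 
        chart_at_in(2)[OF cov] assms(3-5) assms(6)[unfolded has_velocity_within_iff]])
qed

lemma velocity_map:
  assumes "chart_cover A" "chart_cover C" "smooth_map A C F" "continuous (at t within T) \<gamma>" "t \<in> T" 
    and "has_velocity_within A \<gamma> v t T"
  shows "has_velocity_within C (\<lambda>s. F (\<gamma> s)) (differential A C F (\<gamma> t) v) t T"
  unfolding has_velocity_within_iff differential_diff_in
  by (rule velocity_chain[OF assms(1,2,3) chart_at_in(1)[OF assms(1)] chart_at_in(1)[OF assms(2)] UNIV_I 
        chart_at_in(2)[OF assms(1)] chart_at_in(2)[OF assms(2)] assms(4,5) assms(6)[unfolded has_velocity_within_iff]])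

locale conal_homogeneous = lie_homogeneous +
  fixes K
  assumes cones: "cone_field K" and invariant: "differential A A (\<tau> g) x ` K x = K (\<tau> g x)"
begin

lemma cone: "closed (K x)" "convex_cone (K x)" "K x \<inter> uminus ` K x = {0}"
  using cones by (auto simp: cone_field_def)

text \<open>By invariance and openness of the orbit map, the cones at points near \<open>y\<close> are images of
  \<open>K y\<close> under maps close to the identity.\<close>

lemma functional_positive_nearby:
  assumes "\<And>k. k \<in> K y \<Longrightarrow> k \<noteq> 0 \<Longrightarrow> l \<bullet> k > 0"
  obtains T where "open T" "y \<in> T" "T \<subseteq> fst (chart_at A y)"
    "\<And>z u. z \<in> T \<Longrightarrow> u \<in> K z \<Longrightarrow> l \<bullet> diff_in (chart_at A z) (chart_at A y) (\<lambda>x. x) z u \<ge> 0"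
proof -
  let ?c = "chart_at A y"
  note at = chart_at_in[OF coverA]
  obtain m where m: "m > 0" "\<And>k. k \<in> K y \<Longrightarrow> l \<bullet> k \<ge> m * norm k"
    using positive_functional_bound[OF cone(1,2) assms] by metis
  \<comment> \<open>Chosen so that the error \<open>norm l * \<epsilon>\<close> is at most the
    margin \<open>m\<close>; adding 1 covers the case \<open>l = 0\<close>.\<close>
  define \<epsilon> where "\<epsilon> = m / (norm l + 1)"
  have pos: "norm l + 1 > 0" using norm_ge_zero[of l] by linarith
  have \<epsilon>: "\<epsilon> > 0" "norm l * \<epsilon> \<le> m"
    using m(1) pos by (simp_all add: \<epsilon>_def field_simps)
  obtain N where N: "open N" "\<one> \<in> N" "\<And>g. g \<in> N \<Longrightarrow> \<tau> g y \<in> fst ?c"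
    "\<And>g v. g \<in> N \<Longrightarrow> norm (diff_in ?c ?c (\<tau> g) y v - v) \<le> \<epsilon> * norm v"
    using translation_derivative_near_one[OF at[of y] \<epsilon>(1)] by metis
  obtain T where T: "open T" "y \<in> T" "T \<subseteq> (\<lambda>g. \<tau> g y) ` N"
    using orbit_nbhd[OF N(1,2)] by metis
  show thesis
  proof (rule that[OF T(1,2)])
    show "T \<subseteq> fst ?c" using T(3) N(3) by auto
    fix z u assume "z \<in> T" "u \<in> K z"
    then obtain g where g: "g \<in> N" "z = \<tau> g y" using T(3) by auto
    then obtain k where k: "k \<in> K y" "u = diff_in ?c (chart_at A z) (\<tau> g) y k"
      using \<open>u \<in> K z\<close> invariant[of g y] by (auto simp: differential_diff_in)
    \<comment> \<open>Moving \<open>k\<close> to \<open>z\<close> by the translation and reading the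
      result in the chart at \<open>y\<close> amounts to the differential of \<open>\<tau> g\<close>
      in that one chart, where it is close to the identity.\<close>
    have "diff_in (chart_at A z) ?c (\<lambda>x. x) z u = diff_in ?c ?c (\<tau> g) y k"
      unfolding k(2) g(2)
      by (rule diff_in_compose[OF coverA coverA coverA open_UNIV open_UNIV _ smooth_translation smooth_map_on_id[OF atlas]
            at UNIV_I at, symmetric]) (use N(3) g at in auto)
    note eq = this
    have "l \<bullet> k - l \<bullet> diff_in ?c ?c (\<tau> g) y k \<le> m * norm k"
    proof -
      have "l \<bullet> (k - diff_in ?c ?c (\<tau> g) y k) \<le> norm l * norm (k - diff_in ?c ?c (\<tau> g) y k)"
        by (rule norm_cauchy_schwarz)
      also have "\<dots> \<le> norm l * (\<epsilon> * norm k)"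
        using N(4)[OF g(1), of k] by (intro mult_left_mono) (auto simp: norm_minus_commute)
      also have "\<dots> \<le> m * norm k" using mult_right_mono[OF \<epsilon>(2) norm_ge_zero[of k]] by (simp add: mult.assoc)
      finally show ?thesis by (simp add: inner_diff_right)
    qed
    then show "l \<bullet> diff_in (chart_at A z) ?c (\<lambda>x. x) z u \<ge> 0"
      unfolding eq using m(2)[OF k(1)] by linarith
  qed
qed

text \<open>Closedness of the graph of the cone field along a curve. A functional that separates
  \<open>v\<close> from the cone is nonnegative on the velocities at nearby parameters in
  \<open>T\<close>, and continuity of the velocity in the fixed chart passes this on to
  \<open>v\<close>.\<close>

lemma velocity_limit:
  assumes \<delta>: "smooth_map_on euclidean_atlas A W \<delta>" and "open W" "t \<in> W" "T \<subseteq> W" 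
    and nt: "at t within T \<noteq> bot"
    and vel: "\<And>s. s \<in> T \<Longrightarrow> \<exists>u\<in>K (\<delta> s). has_velocity_within A \<delta> u s UNIV"
    and v: "has_velocity_within A \<delta> v t UNIV"
  shows "v \<in> K (\<delta> t)"
proof (rule ccontr)
  assume "v \<notin> K (\<delta> t)"
  let ?c = "chart_at A (\<delta> t)"
  note at = chart_at_in[OF coverA]
  obtain l where l: "\<And>k. k \<in> K (\<delta> t) \<Longrightarrow> k \<noteq> 0 \<Longrightarrow> l \<bullet> k > 0" "l \<bullet> v < 0"
    using convex_cone_separation[OF cone \<open>v \<notin> K (\<delta> t)\<close>] by metis
  obtain P where P: "open P" "\<delta> t \<in> P" "P \<subseteq> fst ?c"
    "\<And>z u. z \<in> P \<Longrightarrow> u \<in> K z \<Longrightarrow> l \<bullet> diff_in (chart_at A z) ?c (\<lambda>x. x) z u \<ge> 0"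
    using functional_positive_nearby[OF l(1)] by metis
  obtain V where V: "continuous_on {t\<in>W. \<delta> t \<in> fst ?c} V"
    "\<And>t. t \<in> W \<Longrightarrow> \<delta> t \<in> fst ?c \<Longrightarrow> ((\<lambda>s. snd ?c (\<delta> s)) has_vector_derivative V t) (at t)"
    by (rule smooth_curve_derivative[OF coverA \<delta> \<open>open W\<close> at(1)[of "\<delta> t"]]) (rule that; blast)
  have cont: "isCont \<delta> s" if "s \<in> W" for s
    using smooth_map_on_continuous[OF \<delta>] \<open>open W\<close> that continuous_on_eq_continuous_at by blast
  have "V t = v"
    using v V(2)[OF \<open>t \<in> W\<close> at(2)] vector_derivative_unique_at by (auto simp: has_velocity_within_iff)
  have "open {s\<in>W. \<delta> s \<in> fst ?c}"
    using continuous_open_preimage[OF smooth_map_on_continuous[OF \<delta>] \<open>open W\<close> is_chartD(1)[OF chart_coverD[OF coverA at(1)]]]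
    by (simp add: Collect_conj_eq vimage_def)
  then have "isCont V t" using V(1) \<open>t \<in> W\<close> at(2) continuous_on_eq_continuous_at by blast
  then have "((\<lambda>s. l \<bullet> V s) \<longlongrightarrow> l \<bullet> v) (at t within T)"
    unfolding \<open>V t = v\<close>[symmetric]
    by (intro tendsto_intros) (auto simp: isCont_def intro: tendsto_within_subset)
  moreover have "\<forall>\<^sub>F s in at t within T. l \<bullet> V s \<ge> 0"
  proof -
    have "\<forall>\<^sub>F s in at t within T. \<delta> s \<in> P"
      using cont[OF \<open>t \<in> W\<close>] P(1,2) topological_tendstoD[of \<delta> "\<delta> t" "at t within T" P]
      by (auto simp: isCont_def intro: tendsto_within_subset)
    moreover have "\<forall>\<^sub>F s in at t within T. s \<in> T" by (simp add: eventually_at_filter)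
    ultimately show ?thesis
    proof eventually_elim
      case (elim s)
      then obtain u where u: "u \<in> K (\<delta> s)" "has_velocity_within A \<delta> u s UNIV" using vel by blast
      have "((\<lambda>s. snd ?c (\<delta> s)) has_vector_derivative diff_in (chart_at A (\<delta> s)) ?c (\<lambda>x. x) (\<delta> s) u) (at s)"
        by (rule velocity_change_chart[OF atlas at(1) _ cont UNIV_I u(2)]) (use elim P(3) \<open>T \<subseteq> W\<close> in auto)
      then have "V s = diff_in (chart_at A (\<delta> s)) ?c (\<lambda>x. x) (\<delta> s) u"
        using V(2)[of s] elim P(3) \<open>T \<subseteq> W\<close> vector_derivative_unique_at by blast
      then show ?case using P(4)[OF elim(1) u(1)] by simp
    qed
  qed
  ultimately have "0 \<le> l \<bullet> v" using nt by (rule tendsto_lowerbound)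
  then show False using l(2) by simp
qed

end

section \<open>Conal curves\<close>

lemma conal_prec_imp_le: "conal_prec A K x y \<Longrightarrow> conal_le A K x y"
  unfolding conal_le_def by (rule subsetD[OF closure_subset]) simp

lemma finite_gap_right:
  fixes t u :: real
  assumes "finite S" "t < u"
  obtains b where "t < b" "b \<le> u" "{t<..<b} \<inter> S = {}"
proof -
  define R where "R = insert u {s\<in>S. s > t}"
  have R: "finite R" "u \<in> R" using assms(1) by (auto simp: R_def)
  show thesis
  proof (rule that)
    show "t < Min R" using R assms(2) by (subst Min_gr_iff) (auto simp: R_def)
    show "Min R \<le> u" using R by simp
    have "s \<notin> {t<..<Min R}" if "s \<in> S" for s
      using that Min_le[OF R(1), of s] by (cases "s > t") (auto simp: R_def)
    then show "{t<..<Min R} \<inter> S = {}" by blast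
  qed
qed

lemma finite_gap_left:
  fixes t u :: real
  assumes "finite S" "u < t"
  obtains a where "a < t" "u \<le> a" "{a<..<t} \<inter> S = {}"
proof -
  obtain b where b: "- t < b" "b \<le> - u" "{- t<..<b} \<inter> uminus ` S = {}"
    using finite_gap_right[of "uminus ` S" "- t" "- u"] assms by auto
  have "s \<notin> {- b<..<t}" if "s \<in> S" for s using b(3) that by force
  then show thesis using b by (intro that[of "- b"]) auto
qed

lemma smooth_arc_map:
  assumes "chart_cover A" "chart_cover C" "smooth_map A C F" "smooth_arc A a b \<gamma>"
  shows "smooth_arc C a b (\<lambda>t. F (\<gamma> t))"
proof -
  obtain W \<delta> where *: "open W" "{a..b} \<subseteq> W" "smooth_map_on euclidean_atlas A W \<delta>" "\<forall>t\<in>{a..b}. \<delta> t = \<gamma> t"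
    using assms(4) by (auto simp: smooth_arc_def)
  have "smooth_map_on euclidean_atlas C W (\<lambda>t. F (\<delta> t))"
    by (rule smooth_map_on_compose[OF chart_cover_euclidean assms(1,2) *(1) open_UNIV _ *(3) assms(3)]) auto
  then show ?thesis unfolding smooth_arc_def using * by (intro exI[of _ W] exI[of _ "\<lambda>t. F (\<delta> t)"]) auto
qed

lemma smooth_arc_affine:
  fixes a r \<alpha> \<beta> :: real
  assumes "chart_cover A" "r > 0" "smooth_arc A (a + r * \<alpha>) (a + r * \<beta>) \<gamma>"
  shows "smooth_arc A \<alpha> \<beta> (\<lambda>s. \<gamma> (a + r * s))"
proof -
  obtain W \<delta> where *: "open W" "{a + r * \<alpha>..a + r * \<beta>} \<subseteq> W" "smooth_map_on euclidean_atlas A W \<delta>" 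
    "\<forall>t\<in>{a + r * \<alpha>..a + r * \<beta>}. \<delta> t = \<gamma> t"
    using assms(3) by (auto simp: smooth_arc_def)
  have W': "open ((\<lambda>s. a + r * s) -` W)" by (intro open_vimage *(1) continuous_intros)
  have "smooth_map_on euclidean_atlas A ((\<lambda>s. a + r * s) -` W) (\<lambda>s. \<delta> (a + r * s))"
    by (rule smooth_map_on_compose[OF chart_cover_euclidean chart_cover_euclidean assms(1) W' *(1) _ 
          smooth_map_on_euclidean[OF smooth_on_affine_real[OF W']] *(3)]) auto
  moreover have range: "a + r * s \<in> {a + r * \<alpha>..a + r * \<beta>}" if "s \<in> {\<alpha>..\<beta>}" for s
    using that assms(2) by simp
  have "{\<alpha>..\<beta>} \<subseteq> (\<lambda>s. a + r * s) -` W" using range *(2) by blast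
  moreover have "\<forall>s\<in>{\<alpha>..\<beta>}. \<delta> (a + r * s) = \<gamma> (a + r * s)" using range *(4) by blast
  ultimately show ?thesis unfolding smooth_arc_def using W' by blast
qed

text \<open>The definition of a conal curve constrains the velocities that exist without asserting
  that any do. Away from break points and ends, existence comes from a smooth arc around
  \<open>t\<close>.\<close>

lemma conal_curve_velocity:
  assumes A: "chart_cover A" and \<gamma>: "conal_curve A K t0 t1 \<gamma>"
  obtains S where "finite S" 
    "\<forall>a b. t0 \<le> a \<longrightarrow> a < b \<longrightarrow> b \<le> t1 \<longrightarrow> {a<..<b} \<inter> S = {} \<longrightarrow> smooth_arc A a b \<gamma>"
    "\<forall>t\<in>{t0<..<t1} - S. \<exists>u\<in>K (\<gamma> t). has_velocity_within A \<gamma> u t UNIV"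
proof -
  obtain S where S: "finite S" 
    "\<And>a b. t0 \<le> a \<Longrightarrow> a < b \<Longrightarrow> b \<le> t1 \<Longrightarrow> {a<..<b} \<inter> S = {} \<Longrightarrow> smooth_arc A a b \<gamma>"
    using \<gamma> by (auto simp: conal_curve_def piecewise_smooth_curve_def)
  have "\<exists>u\<in>K (\<gamma> t). has_velocity_within A \<gamma> u t UNIV" if t: "t \<in> {t0<..<t1} - S" for t
  proof -
    obtain b where b: "t < b" "b \<le> t1" "{t<..<b} \<inter> S = {}" 
      using finite_gap_right[OF S(1), of t t1] t by auto
    obtain a where a: "a < t" "t0 \<le> a" "{a<..<t} \<inter> S = {}" 
      using finite_gap_left[OF S(1), of t0 t] t by auto
    \<comment> \<open>As \<open>t\<close> is not a break point, the gaps on its two sides join to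
      one arc with \<open>t\<close> in its interior, which makes the derivative two-sided.\<close>
    have "{a<..<b} = {a<..<t} \<union> {t} \<union> {t<..<b}" using a b by auto
    then have "smooth_arc A a b \<gamma>" using S(2)[of a b] a b t by auto
    then obtain W \<delta> where \<delta>: "open W" "{a..b} \<subseteq> W" "smooth_map_on euclidean_atlas A W \<delta>" "\<And>t. t\<in>{a..b} \<Longrightarrow> \<delta> t = \<gamma> t"
      by (auto simp: smooth_arc_def)
    let ?c = "chart_at A (\<gamma> t)"
    have tW: "t \<in> W" "\<delta> t \<in> fst ?c"
      using subsetD[OF \<delta>(2), of t] a b \<delta>(4)[of t] chart_at_in(2)[OF A, of "\<gamma> t"] by auto
    have "\<exists>v. ((\<lambda>s. snd ?c (\<delta> s)) has_vector_derivative v) (at t)"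
      by (rule smooth_curve_derivative[OF A \<delta>(3,1) chart_at_in(1)[OF A, of "\<gamma> t"]]) (use tW in blast)
    then obtain v where "((\<lambda>s. snd ?c (\<delta> s)) has_vector_derivative v) (at t)" ..
    then have "((\<lambda>s. snd ?c (\<gamma> s)) has_vector_derivative v) (at t)"
      by (rule has_vector_derivative_transform_within_open[of _ _ _ "{a<..<b}"]) (use a b \<delta>(4) in auto)
    then have v: "has_velocity_within A \<gamma> v t T" for T
      by (auto simp: has_velocity_within_iff intro: has_vector_derivative_at_within)
    then show ?thesis using \<gamma> t by (force simp: conal_curve_def)
  qed
  then show thesis using S by (intro that) blast+
qed

section \<open>Images and restrictions of conal curves\<close>

context conal_homogeneous
begin

text \<open>At break points only one-sided limits of velocities are available; they lie in the cone
  because the cone field has closed graph.\<close>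

lemma conal_curveI:
  assumes "t0 < t1" and cont: "continuous_on {t0..t1} \<gamma>" and S: "finite S" 
    and arc: "\<And>a b. t0 \<le> a \<Longrightarrow> a < b \<Longrightarrow> b \<le> t1 \<Longrightarrow> {a<..<b} \<inter> S = {} \<Longrightarrow> smooth_arc A a b \<gamma>"
    and vel: "\<And>t. t \<in> {t0<..<t1} - S \<Longrightarrow> \<exists>u\<in>K (\<gamma> t). has_velocity_within A \<gamma> u t UNIV"
  shows "conal_curve A K t0 t1 \<gamma>"
  unfolding conal_curve_def
proof (intro conjI ballI allI impI)
  show "piecewise_smooth_curve A t0 t1 \<gamma>"
    unfolding piecewise_smooth_curve_def using cont S arc by blast
  fix t v assume t: "t \<in> {t0..t1}" and v: "has_velocity_within A \<gamma> v t {t0..t1}"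
  \<comment> \<open>An arc with \<open>t\<close> as an end point always exists: to the right of
    \<open>t\<close>, or to the left if \<open>t\<close> is the final parameter.\<close>
  obtain a b where ab: "t0 \<le> a" "a < b" "b \<le> t1" "{a<..<b} \<inter> S = {}" "t \<in> {a..b}"
  proof (cases "t < t1")
    case True
    from finite_gap_right[OF S True] show thesis using t that[of t] by (metis atLeastAtMost_iff order_refl less_imp_le)
  next
    case False
    then have "t0 < t" using t \<open>t0 < t1\<close> by simp
    from finite_gap_left[OF S this] show thesis using t that[of _ t] by (metis atLeastAtMost_iff order_refl less_imp_le)
  qed
  then obtain W \<delta> where \<delta>: "open W" "{a..b} \<subseteq> W" "smooth_map_on euclidean_atlas A W \<delta>" "\<And>t. t\<in>{a..b} \<Longrightarrow> \<delta> t = \<gamma> t"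
    using arc[of a b] by (auto simp: smooth_arc_def)
  let ?c = "chart_at A (\<gamma> t)"
  have tW: "t \<in> W" "\<delta> t \<in> fst ?c"
    using subsetD[OF \<delta>(2), of t] ab(5) \<delta>(4)[of t] chart_at_in(2)[OF coverA, of "\<gamma> t"] by auto
  have "\<exists>v'. ((\<lambda>s. snd ?c (\<delta> s)) has_vector_derivative v') (at t)"
    by (rule smooth_curve_derivative[OF coverA \<delta>(3,1) chart_at_in(1)[OF coverA, of "\<gamma> t"]]) (use tW in blast)
  then obtain v' where v': "((\<lambda>s. snd ?c (\<delta> s)) has_vector_derivative v') (at t)" ..
  have "((\<lambda>s. snd ?c (\<gamma> s)) has_vector_derivative v) (at t within {a..b})"
    using v ab by (auto simp: has_velocity_within_iff intro: has_vector_derivative_within_subset)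
  then have "((\<lambda>s. snd ?c (\<delta> s)) has_vector_derivative v) (at t within {a..b})"
    by (rule has_vector_derivative_transform[OF ab(5), rotated]) (use \<delta>(4) in auto)
  moreover have "((\<lambda>s. snd ?c (\<delta> s)) has_vector_derivative v') (at t within {a..b})"
    by (rule has_vector_derivative_at_within[OF v'])
  \<comment> \<open>Derivatives within a nondegenerate interval are unique, so \<open>v\<close> is
    the velocity of the smooth extension and \<open>velocity_limit\<close> can be applied to
    it.\<close>
  ultimately have "v = v'"
    using vector_derivative_unique_within_closed_interval[OF ab(2), of t] ab(5) by (metis interval_cbox)
  have "v' \<in> K (\<delta> t)"
  proof (rule velocity_limit[OF \<delta>(3,1)])
    show "t \<in> W" "{a<..<b} \<subseteq> W" using ab \<delta>(2) by auto
    have "t \<in> closure {a<..<b}" using ab by simp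
    from islimpt_closure_open[OF open_greaterThanLessThan refl this]
    have "t islimpt {a<..<b}" by (simp only: limpt_of_closure)
    then show "at t within {a<..<b} \<noteq> bot" by (simp add: trivial_limit_within)
    show "has_velocity_within A \<delta> v' t UNIV" using v' \<delta>(4)[OF ab(5)] by (simp add: has_velocity_within_iff)
    fix s assume s: "s \<in> {a<..<b}"
    then obtain u where u: "u \<in> K (\<gamma> s)" "has_velocity_within A \<gamma> u s UNIV"
    proof -
      have "s \<in> {t0<..<t1} - S" using s ab by auto
      from vel[OF this] show thesis using that by blast
    qed
    have "((\<lambda>r. snd (chart_at A (\<gamma> s)) (\<delta> r)) has_vector_derivative u) (at s)"
      by (rule has_vector_derivative_transform_within_open[OF u(2)[unfolded has_velocity_within_iff], of "{a<..<b}"])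
        (use s \<delta>(4) in auto)
    then show "\<exists>u\<in>K (\<delta> s). has_velocity_within A \<delta> u s UNIV"
      using u(1) s \<delta>(4)[of s] by (auto simp: has_velocity_within_iff)
  qed
  then show "v \<in> K (\<gamma> t)" using \<open>v = v'\<close> \<delta>(4)[OF ab(5)] by simp
qed

text \<open>The image curve may have a velocity at a break point where \<open>\<gamma>\<close> has
  none, so the chain rule cannot settle all parameters; \<open>conal_curveI\<close> reduces the
  claim to the regular ones.\<close>

lemma conal_curve_map:
  assumes "t0 < t1" "smooth_map A A F" "differentially_positive A K F" "conal_curve A K t0 t1 \<gamma>"
  shows "conal_curve A K t0 t1 (\<lambda>t. F (\<gamma> t))"
proof -
  obtain S where S: "finite S" 
    "\<forall>a b. t0 \<le> a \<longrightarrow> a < b \<longrightarrow> b \<le> t1 \<longrightarrow> {a<..<b} \<inter> S = {} \<longrightarrow> smooth_arc A a b \<gamma>"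
    "\<forall>t\<in>{t0<..<t1} - S. \<exists>u\<in>K (\<gamma> t). has_velocity_within A \<gamma> u t UNIV"
    by (rule conal_curve_velocity[OF coverA assms(4)])
  have cont: "continuous_on {t0..t1} \<gamma>"
    using assms(4) by (simp add: conal_curve_def piecewise_smooth_curve_def)
  show ?thesis
  proof (rule conal_curveI[OF assms(1) _ S(1)])
    show "continuous_on {t0..t1} (\<lambda>t. F (\<gamma> t))"
      by (rule continuous_on_compose2[OF smooth_map_on_continuous[OF assms(2)] cont]) simp
    show "smooth_arc A a b (\<lambda>t. F (\<gamma> t))" if "t0 \<le> a" "a < b" "b \<le> t1" "{a<..<b} \<inter> S = {}" for a b
      by (rule smooth_arc_map[OF coverA coverA assms(2) S(2)[rule_format, OF that]])
    show "\<exists>u\<in>K (F (\<gamma> t)). has_velocity_within A (\<lambda>t. F (\<gamma> t)) u t UNIV" if t: "t \<in> {t0<..<t1} - S" for t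
    proof -
      obtain u where u: "u \<in> K (\<gamma> t)" "has_velocity_within A \<gamma> u t UNIV" using S(3)[rule_format, OF t] by blast
      have "isCont \<gamma> t" using cont t by (intro continuous_on_interior[OF cont]) auto
      then have "has_velocity_within A (\<lambda>t. F (\<gamma> t)) (differential A A F (\<gamma> t) u) t UNIV"
        by (rule velocity_map[OF coverA coverA assms(2) _ UNIV_I u(2)])
      then show ?thesis using assms(3) u(1) by (auto simp: differentially_positive_def)
    qed
  qed
qed

text \<open>A break point of \<open>\<gamma>\<close> may become an end point of the restriction and
  acquire a one-sided velocity there; \<open>conal_curveI\<close> again takes care of it. Elsewhere
  velocities are scaled by \<open>b - a > 0\<close>, which the cones admit.\<close>

lemma conal_curve_restrict:
  assumes \<gamma>: "conal_curve A K t0 t1 \<gamma>" and ab: "t0 \<le> a" "a < b" "b \<le> t1"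
  shows "conal_curve A K 0 1 (\<lambda>s. \<gamma> (a + (b - a) * s))"
proof -
  obtain S where S: "finite S" 
    "\<forall>a b. t0 \<le> a \<longrightarrow> a < b \<longrightarrow> b \<le> t1 \<longrightarrow> {a<..<b} \<inter> S = {} \<longrightarrow> smooth_arc A a b \<gamma>"
    "\<forall>t\<in>{t0<..<t1} - S. \<exists>u\<in>K (\<gamma> t). has_velocity_within A \<gamma> u t UNIV"
    by (rule conal_curve_velocity[OF coverA \<gamma>])
  have cont: "continuous_on {t0..t1} \<gamma>"
    using \<gamma> by (simp add: conal_curve_def piecewise_smooth_curve_def)
  have r: "b - a > 0" using ab by simp
  have range: "a + (b - a) * s \<in> {a..b}" if "s \<in> {0..1}" for s
    using that r mult_nonneg_nonneg[of "b - a" s] mult_left_le[of s "b - a"]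
    unfolding atLeastAtMost_iff by linarith
  have range': "a + (b - a) * s \<in> {a<..<b}" if "s \<in> {0<..<1}" for s
    using that r mult_pos_pos[of "b - a" s] mult_strict_left_mono[of s 1 "b - a"] 
    unfolding greaterThanLessThan_iff mult_1_right by linarith
  show ?thesis
  proof (rule conal_curveI)
    show "finite ((\<lambda>t. (t - a) / (b - a)) ` S)" using S(1) by simp
    show "continuous_on {0..1} (\<lambda>s. \<gamma> (a + (b - a) * s))"
    proof (rule continuous_on_compose2[OF cont])
      show "continuous_on {0..1} (\<lambda>s. a + (b - a) * s)" by (intro continuous_intros)
      have "{a..b} \<subseteq> {t0..t1}" using ab by auto
      then show "(\<lambda>s. a + (b - a) * s) ` {0..1} \<subseteq> {t0..t1}" using range by blast
    qed
    show "smooth_arc A \<alpha> \<beta> (\<lambda>s. \<gamma> (a + (b - a) * s))" 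
      if *: "0 \<le> \<alpha>" "\<alpha> < \<beta>" "\<beta> \<le> 1" "{\<alpha><..<\<beta>} \<inter> (\<lambda>t. (t - a) / (b - a)) ` S = {}" for \<alpha> \<beta>
    proof (rule smooth_arc_affine[OF coverA r], rule S(2)[rule_format])
      show "t0 \<le> a + (b - a) * \<alpha>" "a + (b - a) * \<beta> \<le> t1" 
        using range[of \<alpha>] range[of \<beta>] * ab unfolding atLeastAtMost_iff by linarith+
      show "a + (b - a) * \<alpha> < a + (b - a) * \<beta>" using * r by simp
      have "t \<notin> {a + (b - a) * \<alpha><..<a + (b - a) * \<beta>}" if "t \<in> S" for t
      proof
        assume "t \<in> {a + (b - a) * \<alpha><..<a + (b - a) * \<beta>}"
        then have "(t - a) / (b - a) \<in> {\<alpha><..<\<beta>}" using r by (simp add: field_simps)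
        then show False using * that by blast
      qed
      then show "{a + (b - a) * \<alpha><..<a + (b - a) * \<beta>} \<inter> S = {}" by blast
    qed
    show "\<exists>u\<in>K (\<gamma> (a + (b - a) * s)). has_velocity_within A (\<lambda>s. \<gamma> (a + (b - a) * s)) u s UNIV" 
      if s: "s \<in> {0<..<1} - (\<lambda>t. (t - a) / (b - a)) ` S" for s
    proof -
      have "a + (b - a) * s \<notin> S"
      proof
        assume "a + (b - a) * s \<in> S"
        then have "((a + (b - a) * s) - a) / (b - a) \<in> (\<lambda>t. (t - a) / (b - a)) ` S" by blast
        then show False using s r by simp
      qed
      then obtain u where u: "u \<in> K (\<gamma> (a + (b - a) * s))" "has_velocity_within A \<gamma> u (a + (b - a) * s) UNIV"
      proof -
        have "a + (b - a) * s \<in> {t0<..<t1} - S"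
          using \<open>a + (b - a) * s \<notin> S\<close> range'[of s] s ab
          unfolding Diff_iff greaterThanLessThan_iff by linarith
        from S(3)[rule_format, OF this] show thesis using that by blast
      qed
      have "((\<lambda>s. a + (b - a) * s) has_vector_derivative (b - a)) (at s)"
        by (auto intro!: derivative_eq_intros simp: has_real_derivative_iff_has_vector_derivative[symmetric])
      from vector_diff_chain_at[OF this u(2)[unfolded has_velocity_within_iff]]
      have "has_velocity_within A (\<lambda>s. \<gamma> (a + (b - a) * s)) ((b - a) *\<^sub>R u) s UNIV"
        by (simp add: has_velocity_within_iff comp_def)
      moreover have "(b - a) *\<^sub>R u \<in> K (\<gamma> (a + (b - a) * s))"
        using convex_cone_scaleR[OF cone(2) _ u(1)] r by simp
      ultimately show ?thesis by blast
    qed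
  qed simp
qed

lemma conal_prec_restrict:
  assumes "conal_curve A K t0 t1 \<gamma>" "t0 \<le> a" "a < b" "b \<le> t1"
  shows "conal_prec A K (\<gamma> a) (\<gamma> b)"
  unfolding conal_prec_def
  by (rule exI[of _ "\<lambda>s. \<gamma> (a + (b - a) * s)"]) (use conal_curve_restrict[OF assms] in auto)

lemma conal_prec_map:
  assumes "smooth_map A A F" "differentially_positive A K F" "conal_prec A K x y"
  shows "conal_prec A K (F x) (F y)"
proof -
  obtain \<gamma> where \<gamma>: "conal_curve A K 0 1 \<gamma>" "\<gamma> 0 = x" "\<gamma> 1 = y"
    using assms(3) by (auto simp: conal_prec_def)
  then show ?thesis
    unfolding conal_prec_def using conal_curve_map[OF zero_less_one assms(1,2) \<gamma>(1)] 
    by (intro exI[of _ "\<lambda>t. F (\<gamma> t)"]) simp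
qed

lemma conal_prec_translate: "conal_prec A K x y \<Longrightarrow> conal_prec A K (\<tau> g x) (\<tau> g y)"
  by (rule conal_prec_map[OF smooth_translation]) (auto simp: differentially_positive_def invariant)

lemma differentially_positive_imp_monotone:
  assumes "smooth_map A A F" "differentially_positive A K F"
  shows "monotone (conal_le A K) (conal_le A K) F"
proof (rule monotoneI)
  fix x y assume "conal_le A K x y"
  then have "F y \<in> F ` closure {z. conal_prec A K x z}" by (simp add: conal_le_def)
  also have "\<dots> \<subseteq> closure {z. conal_prec A K (F x) z}"
    by (rule image_closure_subset)
      (use conal_prec_imp_le[of A K "F x"] conal_prec_map[OF assms] in 
        \<open>auto simp: conal_le_def intro: continuous_on_subset[OF smooth_map_on_continuous[OF assms(1)]]\<close>)
  finally show "conal_le A K (F x) (F y)" by (simp add: conal_le_def)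
qed

section \<open>Functionals along conal curves and on the closed order\<close>

text \<open>The derivative of the functional along the curve is nonnegative except possibly at
  finitely many parameters, so the fundamental theorem of calculus with a finite exceptional set
  gives the inequality.\<close>

lemma functional_mono_along:
  assumes \<gamma>: "conal_curve A K 0 1 \<gamma>" and T: "T \<subseteq> fst (chart_at A y)" "\<gamma> ` {0..1} \<subseteq> T"
    and pos: "\<And>z u. z \<in> T \<Longrightarrow> u \<in> K z \<Longrightarrow> l \<bullet> diff_in (chart_at A z) (chart_at A y) (\<lambda>x. x) z u \<ge> 0"
  shows "l \<bullet> snd (chart_at A y) (\<gamma> 0) \<le> l \<bullet> snd (chart_at A y) (\<gamma> 1)"
proof -
  let ?c = "chart_at A y" and ?f = "\<lambda>t. l \<bullet> snd (chart_at A y) (\<gamma> t)"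
  note at = chart_at_in[OF coverA]
  obtain S where S: "finite S" 
    "\<forall>a b. 0 \<le> a \<longrightarrow> a < b \<longrightarrow> b \<le> 1 \<longrightarrow> {a<..<b} \<inter> S = {} \<longrightarrow> smooth_arc A a b \<gamma>"
    "\<forall>t\<in>{0<..<1} - S. \<exists>u\<in>K (\<gamma> t). has_velocity_within A \<gamma> u t UNIV"
    by (rule conal_curve_velocity[OF coverA \<gamma>])
  have cont: "continuous_on {0..1} \<gamma>"
    using \<gamma> by (simp add: conal_curve_def piecewise_smooth_curve_def)
  have "\<exists>d\<ge>0. (?f has_vector_derivative d) (at t)" if t: "t \<in> {0<..<1} - S" for t
  proof -
    obtain u where u: "u \<in> K (\<gamma> t)" "has_velocity_within A \<gamma> u t UNIV" using S(3)[rule_format, OF t] by blast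
    have "isCont \<gamma> t" using t by (intro continuous_on_interior[OF cont]) auto
    moreover have "\<gamma> t \<in> T" using T(2) t by auto
    ultimately have "((\<lambda>s. snd ?c (\<gamma> s)) has_vector_derivative diff_in (chart_at A (\<gamma> t)) ?c (\<lambda>x. x) (\<gamma> t) u) (at t)"
      using T(1) by (intro velocity_change_chart[OF atlas at(1)] u(2)) auto
    from bounded_linear.has_vector_derivative[OF bounded_linear_inner_right this, of l] 
    show ?thesis using pos[OF \<open>\<gamma> t \<in> T\<close> u(1)] by blast
  qed
  then obtain d where d: "\<And>t. t \<in> {0<..<1} - S \<Longrightarrow> d t \<ge> 0" 
    "\<And>t. t \<in> {0<..<1} - S \<Longrightarrow> (?f has_vector_derivative d t) (at t)" by metis
  \<comment> \<open>The value 0 at the exceptional parameters is arbitrary but keeps the integrand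
    nonnegative everywhere.\<close>
  define d' where "d' t = (if t \<in> {0<..<1} - S then d t else 0)" for t
  have "(d' has_integral (?f 1 - ?f 0)) {0..1}"
  proof (rule fundamental_theorem_of_calculus_interior_strong[OF S(1)])
    have "continuous_on {0..1} (\<lambda>t. snd ?c (\<gamma> t))"
      by (rule continuous_on_compose2[OF is_chartD(4)[OF chart_coverD[OF coverA at(1)]] cont]) (use T in auto)
    then show "continuous_on {0..1} ?f" by (intro continuous_intros)
  qed (use d in \<open>auto simp: d'_def\<close>)
  then have "?f 1 - ?f 0 \<ge> 0"
    by (rule has_integral_nonneg) (use d(1) in \<open>auto simp: d'_def\<close>)
  then show ?thesis by simp
qed

text \<open>A curve from \<open>y\<close> that leaves a compact neighbourhood and returns close to \<open>y\<close> meets its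
  boundary at some \<open>p\<close>; in the limit \<open>y \<le> p \<le> y\<close>, against antisymmetry.\<close>

lemma conal_curve_stays_near:
  assumes antisym: "antisymp (conal_le A K)" and T: "open T" "y \<in> T"
  obtains T' where "open T'" "y \<in> T'" "T' \<subseteq> T"
    "\<And>\<gamma>. conal_curve A K 0 1 \<gamma> \<Longrightarrow> \<gamma> 0 = y \<Longrightarrow> \<gamma> 1 \<in> T' \<Longrightarrow> \<gamma> ` {0..1} \<subseteq> T"
proof -
  obtain W C where W: "open W" "compact C" "y \<in> W" "W \<subseteq> C" "C \<subseteq> T"
    using chart_cover_locally_compact[OF coverA T] by metis
  \<comment> \<open>A curve leaving \<open>C\<close> from \<open>W\<close> has to cross this compact
    collar, which does not contain \<open>y\<close>.\<close>
  define D where "D = C - W"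
  have "compact D" unfolding D_def by (rule compact_diff[OF W(2,1)])
  have "\<exists>P Z. open P \<and> p \<in> P \<and> open Z \<and> y \<in> Z \<and> 
      (\<forall>p'\<in>P. \<forall>z'\<in>Z. \<not> (conal_prec A K y p' \<and> conal_prec A K p' z'))" if "p \<in> D" for p
  proof (cases "conal_le A K y p")
    case False
    \<comment> \<open>If \<open>p\<close> is not above \<open>y\<close>, neither is any point of
      this open set, and \<open>Z\<close> can be everything.\<close>
    let ?P = "- closure {z. conal_prec A K y z}"
    have "\<not> conal_prec A K y p'" if "p' \<in> ?P" for p'
      using that conal_prec_imp_le[of A K y p'] by (auto simp: conal_le_def)
    moreover have "p \<in> ?P" using False by (simp add: conal_le_def)
    ultimately show ?thesis by (intro exI[of _ ?P] exI[of _ UNIV]) auto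
  next
    case True
    have "p \<noteq> y" using that W by (auto simp: D_def)
    then have "\<not> conal_le A K p y" using antisym True by (meson antisympD)
    \<comment> \<open>Failure of \<open>p\<close> to lie below \<open>y\<close> is open in the end
      point by definition of the order. To make it open in the starting point too, a nearby
      \<open>p'\<close> is written as \<open>\<tau> g p\<close> with \<open>g\<close> near
      \<open>\<one>\<close>, and the curve is translated back by \<open>inv g\<close>.\<close>
    define Y where "Y = - closure {z. conal_prec A K p z}"
    have Y: "open Y" "y \<in> Y" using \<open>\<not> conal_le A K p y\<close> by (auto simp: conal_le_def Y_def)
    have "continuous_on UNIV (\<lambda>z. (\<lambda>(g, x). \<tau> g x) (inv (fst z), snd z))"
      using lie by (intro continuous_on_compose2[OF continuous_action] continuous_on_Pair 
        continuous_on_compose2[OF smooth_map_on_continuous[of B B UNIV "\<lambda>g. inv g"]] continuous_intros) 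
        (auto simp: lie_group_def)
    from open_vimage[OF Y(1) this]
    obtain N Z where N: "open N" "open Z" "(\<one>, y) \<in> N \<times> Z" "N \<times> Z \<subseteq> (\<lambda>z. (\<lambda>(g, x). \<tau> g x) (inv (fst z), snd z)) -` Y"
      using Y(2) by (elim open_prod_elim[of _ "(\<one>, y)"]) (auto simp: act_one)
    obtain P where P: "open P" "p \<in> P" "P \<subseteq> (\<lambda>g. \<tau> g p) ` N"
      using orbit_nbhd[of N p] N by auto
    have "\<not> conal_prec A K p' z'" if "p' \<in> P" "z' \<in> Z" for p' z'
    proof
      assume "conal_prec A K p' z'"
      obtain g where g: "g \<in> N" "p' = \<tau> g p" using P(3) \<open>p' \<in> P\<close> by blast
      have "conal_prec A K p (\<tau> (inv g) z')"
        using conal_prec_translate[OF \<open>conal_prec A K p' z'\<close>, of "inv g"] g by simp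
      moreover have "\<tau> (inv g) z' \<in> Y" using N(4) g(1) that(2) by auto
      ultimately show False using conal_prec_imp_le[of A K p] by (auto simp: Y_def conal_le_def)
    qed
    then show ?thesis using P N by (intro exI[of _ P] exI[of _ Z]) auto
  qed
  then have "\<forall>p\<in>D. \<exists>P Z. open P \<and> p \<in> P \<and> open Z \<and> y \<in> Z \<and> 
      (\<forall>p'\<in>P. \<forall>z'\<in>Z. \<not> (conal_prec A K y p' \<and> conal_prec A K p' z'))" by blast
  from bchoice[OF this] obtain P where "\<forall>p\<in>D. \<exists>Z. open (P p) \<and> p \<in> P p \<and> open Z \<and> y \<in> Z \<and> 
      (\<forall>p'\<in>P p. \<forall>z'\<in>Z. \<not> (conal_prec A K y p' \<and> conal_prec A K p' z'))" ..
  from bchoice[OF this] obtain Z where "\<forall>p\<in>D. open (P p) \<and> p \<in> P p \<and> open (Z p) \<and> y \<in> Z p \<and> 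
      (\<forall>p'\<in>P p. \<forall>z'\<in>Z p. \<not> (conal_prec A K y p' \<and> conal_prec A K p' z'))" ..
  then have PZ: "\<And>p. p \<in> D \<Longrightarrow> open (P p)" "\<And>p. p \<in> D \<Longrightarrow> p \<in> P p" 
    "\<And>p. p \<in> D \<Longrightarrow> open (Z p)" "\<And>p. p \<in> D \<Longrightarrow> y \<in> Z p"
    "\<And>p p' z'. p \<in> D \<Longrightarrow> p' \<in> P p \<Longrightarrow> z' \<in> Z p \<Longrightarrow> \<not> (conal_prec A K y p' \<and> conal_prec A K p' z')"
    by blast+
  obtain D' where D': "D' \<subseteq> D" "finite D'" "D \<subseteq> (\<Union>p\<in>D'. P p)"
    by (rule compactE_image[OF \<open>compact D\<close>, of D P]) (use PZ(1,2) in auto)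
  define T' where "T' = W \<inter> (\<Inter>p\<in>D'. Z p)"
  show thesis
  proof (rule that)
    show "open T'" "y \<in> T'" "T' \<subseteq> T" unfolding T'_def using W PZ(3,4) D'(1,2) by (auto intro!: open_INT open_Int)
    fix \<gamma> assume \<gamma>: "conal_curve A K 0 1 \<gamma>" "\<gamma> 0 = y" "\<gamma> 1 \<in> T'"
    have cont: "continuous_on {0..1} \<gamma>"
      using \<gamma> by (simp add: conal_curve_def piecewise_smooth_curve_def)
    have "\<gamma> s \<notin> D" if s: "s \<in> {0..1}" for s
    proof
      assume "\<gamma> s \<in> D"
      moreover have "\<gamma> 0 \<notin> D" "\<gamma> 1 \<notin> D" using \<gamma> W(3) by (auto simp: D_def T'_def)
      ultimately have "0 < s" "s < 1" using s by (metis atLeastAtMost_iff less_eq_real_def)+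
      then have "conal_prec A K y (\<gamma> s)" "conal_prec A K (\<gamma> s) (\<gamma> 1)"
        using conal_prec_restrict[OF \<gamma>(1), of 0 s] conal_prec_restrict[OF \<gamma>(1), of s 1] \<gamma>(2) by auto
      moreover obtain p where "p \<in> D'" "\<gamma> s \<in> P p" using \<open>\<gamma> s \<in> D\<close> D'(3) by blast
      moreover have "\<gamma> 1 \<in> Z p" using \<gamma>(3) \<open>p \<in> D'\<close> by (simp add: T'_def)
      ultimately show False using PZ(5) D'(1) by blast
    qed
    \<comment> \<open>A curve avoiding \<open>D\<close> stays in the union of the disjoint open sets
      \<open>W\<close> and \<open>- C\<close>; by connectedness it remains in \<open>W\<close>,
      where it starts.\<close>
    then have sub: "\<gamma> ` {0..1} \<subseteq> W \<union> - C" by (auto simp: D_def)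
    have "open (- C)" using compact_imp_closed[OF W(2)] by (simp add: open_Compl)
    have "connected (\<gamma> ` {0..1})" by (intro connected_continuous_image cont) simp
    from connectedD[OF this W(1) \<open>open (- C)\<close> _ sub] 
    have "W \<inter> \<gamma> ` {0..1} = {} \<or> - C \<inter> \<gamma> ` {0..1} = {}" using W(4) by blast
    moreover have "\<gamma> 0 \<in> W \<inter> \<gamma> ` {0..1}" using \<gamma>(2) W(3) by auto
    ultimately show "\<gamma> ` {0..1} \<subseteq> T" using W(5) by blast
  qed
qed

text \<open>A point above \<open>y\<close> need not be reached by a conal curve. But a strict
  decrease of the functional is an open condition, so it would already occur at the end point of
  such a curve near \<open>z\<close>, where \<open>functional_mono_along\<close> forbids it.\<close>

lemma functional_mono_near:
  assumes "antisymp (conal_le A K)" "\<And>k. k \<in> K y \<Longrightarrow> k \<noteq> 0 \<Longrightarrow> l \<bullet> k > 0"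
  obtains T where "open T" "y \<in> T" 
    "\<And>z. z \<in> T \<Longrightarrow> conal_le A K y z \<Longrightarrow> l \<bullet> snd (chart_at A y) y \<le> l \<bullet> snd (chart_at A y) z"
proof -
  let ?c = "chart_at A y"
  obtain T where T: "open T" "y \<in> T" "T \<subseteq> fst ?c"
    "\<And>z u. z \<in> T \<Longrightarrow> u \<in> K z \<Longrightarrow> l \<bullet> diff_in (chart_at A z) ?c (\<lambda>x. x) z u \<ge> 0"
    using functional_positive_nearby[OF assms(2)] by metis
  obtain T' where T': "open T'" "y \<in> T'" "T' \<subseteq> T"
    "\<And>\<gamma>. conal_curve A K 0 1 \<gamma> \<Longrightarrow> \<gamma> 0 = y \<Longrightarrow> \<gamma> 1 \<in> T' \<Longrightarrow> \<gamma> ` {0..1} \<subseteq> T"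
    using conal_curve_stays_near[OF assms(1) T(1,2)] by metis
  show thesis
  proof (rule that[OF T'(1,2)])
    fix z assume z: "z \<in> T'" "conal_le A K y z"
    show "l \<bullet> snd ?c y \<le> l \<bullet> snd ?c z"
    proof (rule ccontr)
      assume less: "\<not> l \<bullet> snd ?c y \<le> l \<bullet> snd ?c z"
      have "continuous_on T' (\<lambda>z. l \<bullet> snd ?c z)"
        using T(3) T'(3) by (intro continuous_intros 
            continuous_on_subset[OF is_chartD(4)[OF chart_coverD[OF coverA chart_at_in(1)[OF coverA]]]]) auto
      from continuous_open_preimage[OF this T'(1) open_lessThan, of "l \<bullet> snd ?c y"]
      have "open (T' \<inter> (\<lambda>z. l \<bullet> snd ?c z) -` {..<l \<bullet> snd ?c y})" (is "open ?P") .
      moreover have "z \<in> ?P \<inter> closure {z. conal_prec A K y z}" using z less by (simp add: conal_le_def)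
      ultimately have "?P \<inter> {z. conal_prec A K y z} \<noteq> {}" using open_Int_closure_eq_empty[of ?P] by blast
      then obtain z' where z': "conal_prec A K y z'" "z' \<in> T'" "l \<bullet> snd ?c z' < l \<bullet> snd ?c y"
        by auto
      then obtain \<gamma> where \<gamma>: "conal_curve A K 0 1 \<gamma>" "\<gamma> 0 = y" "\<gamma> 1 = z'" by (auto simp: conal_prec_def)
      have "l \<bullet> snd ?c (\<gamma> 0) \<le> l \<bullet> snd ?c (\<gamma> 1)"
        by (rule functional_mono_along[OF \<gamma>(1) T(3) T'(4)[OF \<gamma>(1,2)] T(4)]) (use \<gamma> z' in auto)
      then show False using z' \<gamma> by simp
    qed
  qed
qed

lemma differential_in_cone:
  assumes "antisymp (conal_le A K)" "smooth_map A A F" "monotone (conal_le A K) (conal_le A K) F"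
    and \<gamma>: "conal_curve A K 0 b \<gamma>" "b > 0" and v: "has_velocity_within A \<gamma> v 0 {0..b}"
  shows "differential A A F (\<gamma> 0) v \<in> K (F (\<gamma> 0))"
proof (rule ccontr)
  let ?y = "F (\<gamma> 0)" and ?w = "differential A A F (\<gamma> 0) v"
  let ?c = "chart_at A ?y"
  assume "?w \<notin> K ?y"
  then obtain l where l: "\<And>k. k \<in> K ?y \<Longrightarrow> k \<noteq> 0 \<Longrightarrow> l \<bullet> k > 0" "l \<bullet> ?w < 0"
    using convex_cone_separation[OF cone] by metis
  obtain T where T: "open T" "?y \<in> T" 
    "\<And>z. z \<in> T \<Longrightarrow> conal_le A K ?y z \<Longrightarrow> l \<bullet> snd ?c ?y \<le> l \<bullet> snd ?c z"
    using functional_mono_near[OF assms(1) l(1)] by metis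
  have cont: "continuous_on {0..b} \<gamma>"
    using \<gamma> by (simp add: conal_curve_def piecewise_smooth_curve_def)
  then have cont0: "continuous (at 0 within {0..b}) \<gamma>"
    using \<gamma>(2) by (simp add: continuous_on_eq_continuous_within)
  have "continuous_on {0..b} (\<lambda>s. F (\<gamma> s))"
    by (rule continuous_on_compose2[OF smooth_map_on_continuous[OF assms(2)] cont]) simp
  then have "((\<lambda>s. F (\<gamma> s)) \<longlongrightarrow> ?y) (at 0 within {0..b})"
    using \<gamma>(2) by (simp add: continuous_on_def)
  then have ev: "\<forall>\<^sub>F s in at 0 within {0..b}. F (\<gamma> s) \<in> T" using T(1,2) by (rule topological_tendstoD)
  let ?g = "\<lambda>s. l \<bullet> snd ?c (F (\<gamma> s))"
  have "has_velocity_within A (\<lambda>s. F (\<gamma> s)) ?w 0 {0..b}"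
    by (rule velocity_map[OF coverA coverA assms(2) cont0 _ v]) (use \<gamma>(2) in simp)
  from bounded_linear.has_vector_derivative[OF bounded_linear_inner_right this[unfolded has_velocity_within_iff], of l]
  have "(?g has_real_derivative l \<bullet> ?w) (at 0 within {0..b})"
    by (simp add: has_real_derivative_iff_has_vector_derivative)
  then have "((\<lambda>s. (?g s - ?g 0) / (s - 0)) \<longlongrightarrow> l \<bullet> ?w) (at 0 within {0..b})"
    by (simp add: has_field_derivative_iff)
  \<comment> \<open>Initial pieces of \<open>\<gamma>\<close> are conal, so
    \<open>\<gamma> s\<close> lies above \<open>\<gamma> 0\<close> and monotonicity passes this to
    the images; the denominator is positive.\<close>
  moreover have "\<forall>\<^sub>F s in at 0 within {0..b}. (?g s - ?g 0) / (s - 0) \<ge> 0"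
  proof -
    have "\<forall>\<^sub>F s in at 0 within {0..b}. s \<in> {0..b} \<and> s \<noteq> 0" by (simp add: eventually_at_filter)
    with ev show ?thesis
    proof eventually_elim
      case (elim s)
      have "conal_prec A K (\<gamma> 0) (\<gamma> s)" using elim by (intro conal_prec_restrict[OF \<gamma>(1)]) auto
      then have "conal_le A K (\<gamma> 0) (\<gamma> s)" by (rule conal_prec_imp_le)
      then have "conal_le A K ?y (F (\<gamma> s))" by (rule monotoneD[OF assms(3)])
      from T(3)[OF elim(1) this] show ?case using elim(2) by simp
    qed
  qed
  moreover have "at 0 within {0..b} \<noteq> bot" using \<gamma>(2) by (simp add: trivial_limit_within islimpt_Icc)
  ultimately have "0 \<le> l \<bullet> ?w" by (rule tendsto_lowerbound)
  then show False using l(2) by simp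
qed

end

section \<open>Integral curves through prescribed tangent vectors\<close>

text \<open>Both composites of \<open>L\<close> and \<open>M\<close> become projections. The second
  identity also allows \<open>M y = 0\<close> to be concluded from
  \<open>L (M y) = 0\<close>.\<close>

lemma linear_pseudo_inverse:
  fixes L :: "'a::euclidean_space \<Rightarrow> 'b::euclidean_space"
  assumes "linear L"
  obtains M where "linear M" "\<And>x. L (M (L x)) = L x" "\<And>y. M (L (M y)) = M y"
proof -
  obtain M0 where M0: "linear M0" "\<forall>v\<in>range L. L (M0 v) = v"
    using linear_exists_right_inverse_on[OF assms subspace_UNIV] by blast
  show thesis
  proof (rule that)
    show "linear (\<lambda>y. M0 (L (M0 y)))"
      using linear_compose[OF linear_compose[OF M0(1) assms] M0(1)] by (simp add: comp_def)
  qed (use M0(2) in auto)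
qed

lemma continuous_on_Blinfun:
  fixes f :: "'c::t2_space \<Rightarrow> 'a::euclidean_space \<Rightarrow> 'b::euclidean_space"
  assumes "\<And>x. x \<in> S \<Longrightarrow> linear (f x)" "\<And>v. continuous_on S (\<lambda>x. f x v)"
  shows "continuous_on S (\<lambda>x. Blinfun (f x))"
proof (rule continuous_on_blinfun_componentwise)
  fix i :: 'a
  show "continuous_on S (\<lambda>x. blinfun_apply (Blinfun (f x)) i)"
    by (rule continuous_on_eq[OF assms(2)[of i]])
      (simp add: bounded_linear_Blinfun_apply assms(1) linear_conv_bounded_linear[symmetric])
qed

text \<open>The rank of the derivative is at most its rank at \<open>p0\<close>, hence near \<open>p0\<close> constant, so the map
  factors locally through the range of its derivative at \<open>p0\<close>.\<close>

lemma rank_deficient_image_negligible: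
  fixes P :: "'a::euclidean_space \<Rightarrow> 'b::euclidean_space"
  assumes D: "open D" "p0 \<in> D" and P: "smooth_on D P" 
    and nonsurj: "\<not> surj (frechet_derivative P (at p0))"
    and rank: "\<And>p. p \<in> D \<Longrightarrow> 
      dim {u. frechet_derivative P (at p0) u = 0} \<le> dim {u. frechet_derivative P (at p) u = 0}"
  obtains U where "open U" "p0 \<in> U" "U \<subseteq> D" "negligible (P ` U)"
proof -
  define P' where "P' p = frechet_derivative P (at p)" for p
  define L where "L = P' p0"
  have P': "(P has_derivative P' p) (at p)" if "p \<in> D" for p
    unfolding P'_def by (rule smooth_on_has_derivative[OF P that])
  have linP': "linear (P' p)" if "p \<in> D" for p using P'[OF that] by (rule has_derivative_linear)
  have linL: "linear L" unfolding L_def by (rule linP'[OF D(2)])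
  obtain M where M: "linear M" "\<And>x. L (M (L x)) = L x" "\<And>y. M (L (M y)) = M y"
    using linear_pseudo_inverse[OF linL] by metis
  have bl: "bounded_linear M" "bounded_linear L" using M(1) linL by (simp_all add: linear_conv_bounded_linear)
  have linML: "linear (\<lambda>u. M (L u))" using linear_compose[OF linL M(1)] by (simp add: comp_def)
  \<comment> \<open>\<open>M\<close> pulls \<open>P\<close> back to the source, and the correction
    term makes the derivative at \<open>p0\<close> the identity, so that the inverse function
    theorem applies.\<close>
  define \<Phi> where "\<Phi> p = M (P p) + (p - M (L p))" for p
  define \<Phi>' where "\<Phi>' p u = M (P' p u) + (u - M (L u))" for p u
  have d\<Phi>: "(\<Phi> has_derivative \<Phi>' p) (at p)" if "p \<in> D" for p
    unfolding \<Phi>_def \<Phi>'_def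
    by (intro has_derivative_add has_derivative_diff has_derivative_ident bounded_linear.has_derivative[OF bl(1)] 
        bounded_linear.has_derivative[OF bl(2)] P' that)
  have lin\<Phi>': "linear (\<Phi>' p)" if "p \<in> D" for p using d\<Phi>[OF that] by (rule has_derivative_linear)
  have app: "blinfun_apply (Blinfun (\<Phi>' p)) = \<Phi>' p" if "p \<in> D" for p
    using lin\<Phi>'[OF that] by (simp add: bounded_linear_Blinfun_apply linear_conv_bounded_linear)
  have cont: "continuous_on D (\<lambda>p. Blinfun (\<Phi>' p))"
  proof (rule continuous_on_Blinfun[OF lin\<Phi>'])
    fix v
    have "continuous_on D (\<lambda>p. P' p v)" 
      unfolding P'_def by (rule smooth_on_continuous[OF smooth_on_derivative[OF P]])
    then show "continuous_on D (\<lambda>p. \<Phi>' p v)"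
      unfolding \<Phi>'_def by (intro continuous_intros bounded_linear.continuous_on[OF bl(1)])
  qed
  have d\<Phi>': "(\<Phi> has_derivative blinfun_apply (Blinfun (\<Phi>' p))) (at p)" if "p \<in> D" for p
    unfolding app[OF that] by (rule d\<Phi>[OF that])
  have id: "id_blinfun o\<^sub>L Blinfun (\<Phi>' p0) = id_blinfun"
    by (rule blinfun_eqI) (simp add: app[OF D(2)] \<Phi>'_def L_def)
  obtain U' V g g' where inv: "open U'" "U' \<subseteq> D" "p0 \<in> U'" "open V" "\<Phi> p0 \<in> V" "homeomorphism U' V \<Phi> g"
    "\<And>y. y \<in> V \<Longrightarrow> (g has_derivative g' y) (at y)"
    "\<And>y. y \<in> V \<Longrightarrow> g' y = inv_into UNIV (blinfun_apply (Blinfun (\<Phi>' (g y))))"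
    "\<And>y. y \<in> V \<Longrightarrow> bij (blinfun_apply (Blinfun (\<Phi>' (g y))))"
    using inverse_function_theorem[OF D(1) d\<Phi>' cont D(2) id] by metis
  have g_in: "g q \<in> U'" "g q \<in> D" if "q \<in> V" for q
    using inv(2,6) that by (auto simp: homeomorphism_def)
  define f where "f q = P (g q)" for q
  define f' where "f' q u = P' (g q) (g' q u)" for q u
  have df: "(f has_derivative f' q) (at q)" if "q \<in> V" for q
    unfolding f_def f'_def by (rule has_derivative_compose[OF inv(7)[OF that] P'[OF g_in(2)[OF that]]])
  \<comment> \<open>In the new coordinates \<open>P\<close> becomes \<open>f\<close>, and the rank
    condition makes its derivative vanish on the kernel of \<open>L\<close>.\<close>
  have f'_ker: "f' q k = 0" if q: "q \<in> V" and k: "L k = 0" for q k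
  proof -
    define u where "u = g' q k"
    note p = g_in(2)[OF q]
    have bij: "bij (\<Phi>' (g q))" using inv(9)[OF q] app[OF p] by simp
    have "\<Phi>' (g q) u = k" unfolding u_def inv(8)[OF q] app[OF p] using bij by (simp add: bij_is_surj surj_f_inv_f)
    then have eq: "M (P' (g q) u) + (u - M (L u)) = k" by (simp add: \<Phi>'_def)
    have "L (M (P' (g q) u)) = 0"
    proof -
      have "L (M (P' (g q) u) + (u - M (L u))) = L (M (P' (g q) u)) + (L u - L (M (L u)))"
        by (simp add: linear_add[OF linL] linear_diff[OF linL])
      then show ?thesis using eq k M(2) by simp
    qed
    then have MP: "M (P' (g q) u) = 0" by (metis M(3) linear_0[OF M(1)])
    let ?N1 = "{u. P' (g q) u = 0}" and ?N2 = "{u. M (P' (g q) u) = 0}"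
    have linMP: "linear (\<lambda>u. M (P' (g q) u))" using linear_compose[OF linP'[OF p] M(1)] by (simp add: comp_def)
    \<comment> \<open>On \<open>?N2\<close> the injective map \<open>\<Phi>' (g q)\<close> acts as
      \<open>u - M (L u)\<close>, which lies in the kernel of \<open>L\<close>. The rank condition
      bounds that kernel by \<open>?N1\<close>, and since \<open>?N1\<close> is contained in
      \<open>?N2\<close> the two agree.\<close>
    have "dim ?N2 = dim (\<Phi>' (g q) ` ?N2)"
      by (rule dim_image_eq[OF lin\<Phi>'[OF p], symmetric]) (use bij in \<open>auto simp: bij_def intro: inj_on_subset\<close>)
    also have "\<dots> \<le> dim {u. L u = 0}"
      by (rule dim_subset) (auto simp: \<Phi>'_def linear_diff[OF linL] M(2))
    also have "\<dots> \<le> dim ?N1" using rank[OF p] by (simp add: L_def P'_def)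
    finally have "?N1 = ?N2"
      by (intro subspace_dim_equal linear_subspace_kernel linP'[OF p] linMP) (auto simp: linear_0[OF M(1)])
    then show ?thesis using MP by (auto simp: f'_def u_def)
  qed
  define q0 where "q0 = \<Phi> p0"
  obtain r where r: "r > 0" "ball q0 r \<subseteq> V" using inv(4,5) openE unfolding q0_def by blast
  obtain C where C: "C > 0" "\<And>v. norm (M (L v)) \<le> norm v * C"
    using bounded_linear.pos_bounded[of "\<lambda>u. M (L u)"] linML unfolding linear_conv_bounded_linear by blast
  \<comment> \<open>Both \<open>q\<close> and its projection \<open>q0 + M (L (q - q0))\<close> must
    lie in the ball of radius \<open>r\<close>; the projection enlarges distances from
    \<open>q0\<close> by at most the factor \<open>C\<close>.\<close>
  define r' where "r' = r / (C + 1)"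
  have r': "r' > 0" "r' \<le> r" "r' * C \<le> r" 
    using r(1) C(1) by (auto simp: r'_def field_simps)
  define h where "h y = f (q0 + M y)" for y
  \<comment> \<open>The segment from the projection of \<open>q\<close> to \<open>q\<close> points
    into the kernel of \<open>L\<close>, so \<open>f\<close> is constant along it.\<close>
  have fh: "f q = h (L (q - q0))" "q0 + M (L (q - q0)) \<in> ball q0 r" if q: "q \<in> ball q0 r'" for q
  proof -
    let ?q = "q0 + M (L (q - q0))"
    have nq: "norm (q - q0) < r'" using q by (simp add: dist_norm norm_minus_commute)
    have "norm (M (L (q - q0))) \<le> norm (q - q0) * C" by (rule C(2))
    also have "\<dots> < r' * C" using nq C(1) by simp
    finally show *: "?q \<in> ball q0 r" using r'(3) by (simp add: dist_norm)
    have "q \<in> ball q0 r" using q r'(2) by auto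
    have seg: "?q + t *\<^sub>R (q - ?q) \<in> V" if "t \<in> {0..1}" for t
    proof -
      have "(1 - t) *\<^sub>R ?q + t *\<^sub>R q \<in> ball q0 r"
        using that * \<open>q \<in> ball q0 r\<close> by (intro convexD[OF convex_ball]) auto
      then show ?thesis using r(2) by (auto simp: algebra_simps)
    qed
    have ker: "L (q - ?q) = 0"
    proof -
      have "q - ?q = (q - q0) - M (L (q - q0))" by simp
      then show ?thesis by (metis M(2) diff_self linear_diff[OF linL])
    qed
    have "((\<lambda>t. f (?q + t *\<^sub>R (q - ?q))) has_derivative (\<lambda>s. 0)) (at t within {0..1})" if t: "t \<in> {0..1}" for t
    proof -
      have "((\<lambda>t. ?q + t *\<^sub>R (q - ?q)) has_derivative (\<lambda>s. s *\<^sub>R (q - ?q))) (at t within {0..1})"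
        by (auto intro!: derivative_eq_intros)
      from has_derivative_compose[OF this df[OF seg[OF t]]]
      have "((\<lambda>t. f (?q + t *\<^sub>R (q - ?q))) has_derivative (\<lambda>s. f' (?q + t *\<^sub>R (q - ?q)) (s *\<^sub>R (q - ?q)))) (at t within {0..1})" .
      moreover have "f' (?q + t *\<^sub>R (q - ?q)) (s *\<^sub>R (q - ?q)) = 0" for s
        by (rule f'_ker[OF seg[OF t]]) (simp add: linear_cmul[OF linL] ker)
      ultimately show ?thesis by simp
    qed
    from has_derivative_zero_unique[OF _ this, of 1 0]
    show "f q = h (L (q - q0))" by (simp add: h_def)
  qed
  \<comment> \<open>The piece of the lower-dimensional range of \<open>L\<close> on which
    \<open>h\<close> is differentiable; differentiable images of null sets in equal dimension are
    null.\<close>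
  define S where "S = range L \<inter> {y. q0 + M y \<in> ball q0 r}"
  have "negligible S"
  proof -
    have "span (range L) = range L" by (rule span_eq_iff[THEN iffD2, OF linear_subspace_image[OF linL subspace_UNIV]])
    moreover have "range L \<noteq> UNIV" using nonsurj by (simp add: L_def P'_def)
    ultimately have "dim (range L) \<noteq> DIM('b)" by (metis dim_eq_full)
    then have "dim (range L) < DIM('b)" using dim_subset_UNIV[of "range L"] by simp
    then show ?thesis using negligible_lowdim negligible_subset unfolding S_def by blast
  qed
  moreover have "h differentiable_on S"
    unfolding differentiable_on_def
  proof
    fix y assume "y \<in> S"
    then have "q0 + M y \<in> V" using r(2) by (auto simp: S_def)
    have "((\<lambda>y. q0 + M y) has_derivative M) (at y within S)"
      by (auto intro!: derivative_eq_intros bounded_linear_imp_has_derivative bl(1))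
    from has_derivative_compose[OF this df[OF \<open>q0 + M y \<in> V\<close>]]
    show "h differentiable at y within S" unfolding h_def differentiable_def by blast
  qed
  ultimately have neg: "negligible (h ` S)" by (intro negligible_differentiable_image_negligible) auto
  show thesis
  proof (rule that)
    have "continuous_on U' \<Phi>" using inv(6) by (simp add: homeomorphism_def)
    from continuous_open_preimage[OF this inv(1) open_ball]
    show "open (U' \<inter> \<Phi> -` ball q0 r')" .
    show "p0 \<in> U' \<inter> \<Phi> -` ball q0 r'" using inv(3) r'(1) by (simp add: q0_def)
    show "U' \<inter> \<Phi> -` ball q0 r' \<subseteq> D" using inv(2) by auto
    have "P ` (U' \<inter> \<Phi> -` ball q0 r') \<subseteq> h ` S"
    proof clarify
      fix p assume p: "p \<in> U'" "\<Phi> p \<in> ball q0 r'"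
      have "P p = f (\<Phi> p)" using inv(6) p(1) by (simp add: f_def homeomorphism_def)
      with fh[OF p(2)] show "P p \<in> h ` S" by (auto simp: S_def)
    qed
    with neg show "negligible (P ` (U' \<inter> \<Phi> -` ball q0 r'))" by (rule negligible_subset)
  qed
qed

section \<open>The orbit map is a submersion\<close>

context lie_action
begin

lemma regular_translation_derivative:
  assumes b: "b \<in> B" "\<one> \<in> fst b" "g \<in> fst b"
  defines "M \<equiv> (\<lambda>z. snd b (inv_into (fst b) (snd b) (fst z) \<otimes> inv_into (fst b) (snd b) (snd z)))"
  shows "diff_in b b (\<lambda>h. g \<otimes> h) \<one> v = frechet_derivative M (at (snd b g, snd b \<one>)) (0, v)"
proof -
  interpret R: lie_action G B B "\<lambda>g h. g \<otimes> h" by (rule regular_action)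
  show ?thesis unfolding M_def by (rule R.translation_derivative) (use b in auto)
qed

text \<open>Both sides are the derivative at \<open>h = \<one>\<close> of
  \<open>\<tau> (g \<otimes> h) x = \<tau> g (\<tau> h x)\<close>.\<close>

lemma orbit_map_equivariant:
  assumes b: "b \<in> B" "\<one> \<in> fst b" "g \<in> fst b" and c: "c \<in> A" "x \<in> fst c" and d: "d \<in> A" "\<tau> g x \<in> fst d"
  shows "diff_in b d (\<lambda>g. \<tau> g x) g (diff_in b b (\<lambda>h. g \<otimes> h) \<one> v) = 
    diff_in c d (\<tau> g) x (diff_in b c (\<lambda>g. \<tau> g x) \<one> v)"
proof -
  interpret R: lie_action G B B "\<lambda>g h. g \<otimes> h" by (rule regular_action)
  have "diff_in b d (\<lambda>h. \<tau> (g \<otimes> h) x) \<one> v = diff_in b d (\<lambda>g. \<tau> g x) (g \<otimes> \<one>) (diff_in b b (\<lambda>h. g \<otimes> h) \<one> v)"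
    by (rule diff_in_compose[OF coverB coverB coverA open_UNIV open_UNIV _ R.smooth_translation smooth_orbit_map])
      (use b d in auto)
  moreover have "diff_in b d (\<lambda>h. \<tau> g (\<tau> h x)) \<one> v = diff_in c d (\<tau> g) (\<tau> \<one> x) (diff_in b c (\<lambda>g. \<tau> g x) \<one> v)"
    by (rule diff_in_compose[OF coverB coverA coverA open_UNIV open_UNIV _ smooth_orbit_map smooth_translation])
      (use b c d in \<open>auto simp: act_one\<close>)
  ultimately show ?thesis by (simp add: act_mult act_one)
qed

end

context lie_homogeneous
begin

text \<open>Left translation by \<open>g\<close> maps the kernel of the differential at
  \<open>\<one>\<close> injectively into the kernel at \<open>g\<close>, so the rank near
  \<open>\<one>\<close> is at most the rank at \<open>\<one>\<close>. Were the latter deficient, a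
  neighbourhood of \<open>\<one>\<close> would have a negligible image in coordinates, yet
  \<open>orbit_nbhd\<close> finds an open set in it.\<close>

lemma orbit_map_submersion:
  assumes b: "b \<in> B" "\<one> \<in> fst b" and c: "c \<in> A" "x \<in> fst c"
  shows "surj (diff_in b c (\<lambda>g. \<tau> g x) \<one>)"
proof (rule ccontr)
  assume nonsurj: "\<not> surj (diff_in b c (\<lambda>g. \<tau> g x) \<one>)"
  interpret R: lie_action G B B "\<lambda>g h. g \<otimes> h" by (rule regular_action)
  note chb = chart_coverD[OF coverB b(1)] and chc = chart_coverD[OF coverA c(1)]
  let ?\<pi> = "\<lambda>g. \<tau> g x"
  define P where "P = local_rep b c ?\<pi>"
  \<comment> \<open>With a relative error of 1/2 the differential of left translation can kill no
    nonzero vector.\<close>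
  obtain N where N: "open N" "\<one> \<in> N" "\<And>g. g \<in> N \<Longrightarrow> g \<otimes> \<one> \<in> fst b"
    "\<And>g v. g \<in> N \<Longrightarrow> norm (diff_in b b (\<lambda>h. g \<otimes> h) \<one> v - v) \<le> 1/2 * norm v"
    using R.translation_derivative_near_one[OF b half_gt_zero[OF zero_less_one]] by metis
  define D where "D = snd b ` (fst b \<inter> (N \<inter> ?\<pi> -` fst c))"
  have "open (?\<pi> -` fst c)" by (rule open_vimage[OF is_chartD(1)[OF chc] continuous_orbit_map])
  then have "open D" unfolding D_def by (intro chart_image_open chb open_Int N(1))
  have "snd b \<one> \<in> D" unfolding D_def using b c N(2) by (auto simp: act_one)
  have smooth: "smooth_on D P" unfolding P_def
    by (rule smooth_on_subset[OF smooth_map_onD[OF smooth_orbit_map b(1) c(1)]]) (auto simp: D_def)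
  have lin: "linear (diff_in b c ?\<pi> g)" if "g \<in> fst b" "\<tau> g x \<in> fst c" for g
    by (rule has_derivative_linear[OF local_rep_has_derivative[OF smooth_orbit_map b(1) c(1) UNIV_I that]])
  have rank: "dim {u. frechet_derivative P (at (snd b \<one>)) u = 0} \<le> dim {u. frechet_derivative P (at p) u = 0}" 
    if "p \<in> D" for p
  proof -
    obtain g where g: "p = snd b g" "g \<in> fst b" "g \<in> N" "\<tau> g x \<in> fst c" using \<open>p \<in> D\<close> by (auto simp: D_def)
    let ?\<Lambda> = "diff_in b b (\<lambda>h. g \<otimes> h) \<one>"
    have lin\<Lambda>: "linear ?\<Lambda>"
      by (rule has_derivative_linear[OF local_rep_has_derivative[OF R.smooth_translation b(1) b(1) UNIV_I b(2)]])
        (use g in simp)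
    have "inj ?\<Lambda>"
    proof (rule linear_injective_0[OF lin\<Lambda>, THEN iffD2], intro allI impI)
      fix v assume "?\<Lambda> v = 0"
      then show "v = 0" using N(4)[OF g(3), of v] by simp
    qed
    then have "dim {u. diff_in b c ?\<pi> \<one> u = 0} = dim (?\<Lambda> ` {u. diff_in b c ?\<pi> \<one> u = 0})"
      by (intro dim_image_eq[OF lin\<Lambda>, symmetric]) (auto intro: inj_on_subset)
    also have "\<dots> \<le> dim {u. diff_in b c ?\<pi> g u = 0}"
    proof (rule dim_subset, clarify)
      fix u assume "diff_in b c ?\<pi> \<one> u = 0"
      then have "diff_in b c ?\<pi> g (?\<Lambda> u) = diff_in c c (\<tau> g) x 0"
        using orbit_map_equivariant[OF b g(2) c c(1) g(4)] by simp
      also have "\<dots> = 0"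
        by (rule linear_0[OF has_derivative_linear[OF local_rep_has_derivative[OF smooth_translation c(1) c(1) UNIV_I c(2) g(4)]]])
      finally show "diff_in b c ?\<pi> g (?\<Lambda> u) = 0" .
    qed
    finally show ?thesis by (simp add: diff_in_def P_def g(1))
  qed
  have "\<not> surj (frechet_derivative P (at (snd b \<one>)))" using nonsurj by (simp add: diff_in_def P_def)
  from rank_deficient_image_negligible[OF \<open>open D\<close> \<open>snd b \<one> \<in> D\<close> smooth this rank]
  obtain U where U: "open U" "snd b \<one> \<in> U" "U \<subseteq> D" "negligible (P ` U)" by blast
  have "open (fst b \<inter> snd b -` U)"
    by (rule continuous_open_preimage[OF is_chartD(4,1)[OF chb] U(1)])
  moreover have "\<one> \<in> fst b \<inter> snd b -` U" using b(2) U(2) by simp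
  ultimately obtain T where T: "open T" "x \<in> T" "T \<subseteq> ?\<pi> ` (fst b \<inter> snd b -` U)"
    by (rule orbit_nbhd)
  have "snd c ` (fst c \<inter> T) \<subseteq> P ` U"
  proof clarify
    fix z assume "z \<in> fst c" "z \<in> T"
    then obtain g where g: "g \<in> fst b" "snd b g \<in> U" "z = \<tau> g x" using T(3) by auto
    then have "snd c z = P (snd b g)" by (simp add: P_def local_rep_def is_chartD(6)[OF chb])
    then show "snd c z \<in> P ` U" using g(2) by blast
  qed
  with U(4) have "negligible (snd c ` (fst c \<inter> T))" by (rule negligible_subset)
  moreover have "open (snd c ` (fst c \<inter> T))" by (rule chart_image_open[OF chc T(1)])
  moreover have "snd c ` (fst c \<inter> T) \<noteq> {}" using c(2) T(2) by blast
  ultimately show False using open_not_negligible by blast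
qed

end

context conal_homogeneous
begin

text \<open>The curve is \<open>t \<mapsto> exp (t \<xi>) x\<close>, with the one-parameter group obtained locally as an integral
  curve of the left-invariant vector field of \<open>\<xi>\<close>; left invariance makes its velocity at
  \<open>g x\<close> the translate by \<open>g\<close> of its velocity \<open>v\<close> at \<open>x\<close>.\<close>

lemma conal_curve_exists:
  assumes v: "v \<in> K x"
  obtains \<gamma> a where "a > 0" "conal_curve A K 0 a \<gamma>" "\<gamma> 0 = x" "has_velocity_within A \<gamma> v 0 {0..a}"
proof -
  interpret R: lie_action G B B "\<lambda>g h. g \<otimes> h" by (rule regular_action)
  note at = chart_at_in[OF coverA]
  let ?c = "chart_at A x" and ?\<pi> = "\<lambda>g. \<tau> g x"
  obtain b where b: "b \<in> B" "\<one> \<in> fst b" using chart_coverE[OF coverB] by metis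
  note chb = is_chartD[OF chart_coverD[OF coverB b(1)]]
  let ?inv = "inv_into (fst b) (snd b)"
  obtain \<xi> where \<xi>: "diff_in b ?c ?\<pi> \<one> \<xi> = v"
    using orbit_map_submersion[OF b at] by (metis surjD)
  define M where "M = (\<lambda>z. snd b (?inv (fst z) \<otimes> ?inv (snd z)))"
  define D where "D = snd b ` fst b"
  have "open D" unfolding D_def by (rule chb(2))
  \<comment> \<open>The left-invariant field of \<xi> in chart coordinates, as a partial derivative
    of the multiplication; in this form its smoothness is visible.\<close>
  define V where "V p = frechet_derivative M (at (p, snd b \<one>)) (0, \<xi>)" for p
  have V_eq: "V (snd b g) = diff_in b b (\<lambda>h. g \<otimes> h) \<one> \<xi>" if "g \<in> fst b" for g
    unfolding V_def M_def using regular_translation_derivative[OF b that] by simp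
  have "smooth_on D V"
    unfolding V_def
  proof (rule smooth_on_compose[OF \<open>open D\<close>, where g = "\<lambda>z. frechet_derivative M (at z) (0, \<xi>)"])
    note two = smooth_two_variables[OF coverB coverB coverB R.smooth_action b(1) b(1) b(1)]
    show "open {(p, q). p \<in> snd b ` fst b \<and> q \<in> snd b ` fst b \<and> (\<lambda>(g, h). g \<otimes> h) (?inv p, ?inv q) \<in> fst b}"
      by (rule two(1))
    show "smooth_on {(p, q). p \<in> snd b ` fst b \<and> q \<in> snd b ` fst b \<and> (\<lambda>(g, h). g \<otimes> h) (?inv p, ?inv q) \<in> fst b}
       (\<lambda>z. frechet_derivative M (at z) (0, \<xi>))"
      unfolding M_def using smooth_on_derivative[OF two(2)] by simp
    show "(\<lambda>p. (p, snd b \<one>)) ` D \<subseteq> 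
      {(p, q). p \<in> snd b ` fst b \<and> q \<in> snd b ` fst b \<and> (\<lambda>(g, h). g \<otimes> h) (?inv p, ?inv q) \<in> fst b}"
      using b(2) chb(6) by (auto simp: D_def)
    show "smooth_on D (\<lambda>p. (p, snd b \<one>))"
      by (intro smooth_on_Pair smooth_on_const \<open>open D\<close> smooth_on_linear[OF _ bounded_linear_ident])
  qed
  then obtain a p where p: "a > 0" "p 0 = snd b \<one>" "\<And>t. t \<in> {-a<..<a} \<Longrightarrow> p t \<in> D"
    "\<And>t. t \<in> {-a<..<a} \<Longrightarrow> (p has_vector_derivative V (p t)) (at t)"
    using picard_lindeloef[OF \<open>open D\<close> \<open>smooth_on D V\<close>, of "snd b \<one>"] b(2) unfolding D_def by blast
  define W where "W = {-a<..<a}"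
  have W: "open W" by (simp add: W_def)
  have "smooth_on W p"
    by (rule solution_smooth[OF W \<open>open D\<close> \<open>smooth_on D V\<close>]) (use p(3,4) in \<open>auto simp: W_def\<close>)
  define \<eta> where "\<eta> t = ?inv (p t)" for t
  have \<eta>: "smooth_map_on euclidean_atlas B W \<eta>"
    unfolding \<eta>_def
    by (rule smooth_map_on_compose[OF chart_cover_euclidean chart_cover_euclidean coverB W chb(2) _ 
          smooth_map_on_euclidean[OF \<open>smooth_on W p\<close>] smooth_map_on_inv_chart[OF atlasB b(1)]])
      (use p(3) in \<open>auto simp: W_def D_def\<close>)
  have \<eta>_in: "\<eta> t \<in> fst b" "snd b (\<eta> t) = p t" if "t \<in> W" for t
    using p(3)[of t] that unfolding \<eta>_def W_def D_def by (auto simp: inv_into_into f_inv_into_f)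
  define \<gamma> where "\<gamma> t = \<tau> (\<eta> t) x" for t
  have \<gamma>: "smooth_map_on euclidean_atlas A W \<gamma>"
    unfolding \<gamma>_def
    by (rule smooth_map_on_compose[OF chart_cover_euclidean coverB coverA W open_UNIV _ \<eta> smooth_orbit_map]) simp
  have vel: "has_velocity_within A \<gamma> (differential A A (\<tau> (\<eta> t)) x v) t T" if "t \<in> W" for t T
  proof -
    let ?d = "chart_at A (\<tau> (\<eta> t) x)"
    have "isCont \<eta> t" using smooth_map_on_continuous[OF \<eta>] W that continuous_on_eq_continuous_at by blast
    moreover have "((\<lambda>s. snd b (\<eta> s)) has_vector_derivative V (p t)) (at t)"
      by (rule has_vector_derivative_transform_within_open[OF p(4) W that]) (use that \<eta>_in in \<open>auto simp: W_def\<close>)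
    ultimately have "((\<lambda>s. snd ?d (\<tau> (\<eta> s) x)) has_vector_derivative diff_in b ?d ?\<pi> (\<eta> t) (V (p t))) (at t)"
      by (intro velocity_chain[where f = ?\<pi> and \<gamma> = \<eta>, OF coverB coverA smooth_orbit_map b(1) at(1)] 
          UNIV_I \<eta>_in(1)[OF that] at(2))
    also have "diff_in b ?d ?\<pi> (\<eta> t) (V (p t)) = differential A A (\<tau> (\<eta> t)) x v"
      using orbit_map_equivariant[OF b \<eta>_in(1)[OF that] at at, of x \<xi>] V_eq[OF \<eta>_in(1)[OF that]] \<eta>_in(2)[OF that] \<xi>
      by (simp add: differential_diff_in)
    finally show ?thesis
      by (auto simp: has_velocity_within_iff \<gamma>_def intro: has_vector_derivative_at_within)
  qed
  have \<eta>0: "\<eta> 0 = \<one>" using p(2) chb(6)[OF b(2)] by (simp add: \<eta>_def)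
  \<comment> \<open>The solution lives on an open interval; halving leaves a compact interval inside
    it, with \<open>W\<close> as the neighbourhood that a smooth arc requires.\<close>
  have sub: "{0..a/2} \<subseteq> W" using p(1) by (auto simp: W_def)
  show thesis
  proof (rule that)
    show "a / 2 > 0" using p(1) by simp
    show "\<gamma> 0 = x" by (simp add: \<gamma>_def \<eta>0 act_one)
    have "differential A A (\<tau> \<one>) x v = v"
      using translation_derivative_one[OF at] by (simp add: differential_diff_in act_one)
    then show "has_velocity_within A \<gamma> v 0 {0..a/2}"
      using vel[of 0] sub p(1) by (auto simp: \<eta>0 W_def)
    show "conal_curve A K 0 (a/2) \<gamma>"
    proof (rule conal_curveI[where S = "{}"])
      show "continuous_on {0..a/2} \<gamma>" by (rule continuous_on_subset[OF smooth_map_on_continuous[OF \<gamma>] sub])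
      show "smooth_arc A s t \<gamma>" if "0 \<le> s" "t \<le> a/2" for s t
      proof -
        have "{s..t} \<subseteq> W" using that sub by fastforce
        then show ?thesis unfolding smooth_arc_def using W \<gamma> by blast
      qed
      show "\<exists>u\<in>K (\<gamma> t). has_velocity_within A \<gamma> u t UNIV" if "t \<in> {0<..<a/2} - {}" for t
      proof -
        have "t \<in> W" using that sub by auto
        moreover have "differential A A (\<tau> (\<eta> t)) x v \<in> K (\<gamma> t)"
          unfolding \<gamma>_def invariant[symmetric] using v by blast
        ultimately show ?thesis using vel by blast
      qed
    qed (use p(1) in auto)
  qed
qed

lemma monotone_imp_differentially_positive:
  assumes "antisymp (conal_le A K)" "smooth_map A A F" "monotone (conal_le A K) (conal_le A K) F"
  shows "differentially_positive A K F"
  unfolding differentially_positive_def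
proof (intro allI subsetI)
  fix x w assume "w \<in> differential A A F x ` K x"
  then obtain v where v: "v \<in> K x" "w = differential A A F x v" by blast
  obtain \<gamma> a where "a > 0" "conal_curve A K 0 a \<gamma>" "\<gamma> 0 = x" "has_velocity_within A \<gamma> v 0 {0..a}"
    using conal_curve_exists[OF v(1)] by metis
  then show "w \<in> K (F x)"
    using differential_in_cone[OF assms, of a \<gamma> v] v(2) by simp
qed

end

theorem mainTheorem2:
  fixes G :: "('g::{t2_space, second_countable_topology}) monoid"
    and B :: "('g, 'd::euclidean_space) chart set"
    and A :: "('m::{t2_space, second_countable_topology}, 'e::euclidean_space) chart set"
    and \<tau> :: "'g \<Rightarrow> 'm \<Rightarrow> 'm"
    and K :: "'m \<Rightarrow> 'e set"
    and F :: "'m \<Rightarrow> 'm"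
  assumes "homogeneous_space G B A \<tau>"
    and "homogeneous_cone_field G A \<tau> K"
    and "globally_orderable A K"
    and "smooth_map A A F"
  shows "monotone (conal_le A K) (conal_le A K) F \<longleftrightarrow> differentially_positive A K F"
proof -
  have carrier: "carrier G = UNIV"
    using assms(1) by (simp add: homogeneous_space_def lie_group_def)
  interpret T: transitive_action G UNIV \<tau>
    using assms(1) by (simp add: homogeneous_space_def)
  have one: "\<tau> \<one>\<^bsub>G\<^esub> x = x" for x
    using T.id_eq_one by (metis UNIV_I restrict_apply')
  have mult: "\<tau> (g \<otimes>\<^bsub>G\<^esub> h) x = \<tau> g (\<tau> h x)" for g h x
    by (rule T.composition_rule) (auto simp: carrier)
  have trans: "\<exists>g. \<tau> g x = y" for x y
    using T.unique_orbit[of x y] by auto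
  interpret conal_homogeneous G B A \<tau> K
    using assms(1,2) one mult trans
    by unfold_locales (auto simp: homogeneous_space_def homogeneous_cone_field_def lie_group_def)
  show ?thesis
    using differentially_positive_imp_monotone[OF assms(4)] monotone_imp_differentially_positive[OF _ assms(4)] 
      assms(3) by (auto simp: globally_orderable_def)
qed

end
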